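(* Let $G$ be a countable group and $H$ a normal subgroup of $G$. If $H$ is linear sofic and $G/H$ is amenable, then $G$ is linear sofic.
   Context: A countable group is linear sofic if it admits an injective group morphism into $\prod_{k\to\omega}GL_{n_k}(\mathbb{C})/d_\omega$ for some non-principal ultrafilter $\omega$ on $\mathbb{N}$ and $n_k\to\infty$, where this is the quotient of $\prod_kGL_{n_k}(\mathbb{C})$ by $\{(a_k)_k:\lim_{k\to\omega}\rho(a_k-\mathrm{Id})=0\}$ and $\rho(a)=\operatorname{rk}(a)/n$ for $a\in M_n(\mathbb{C})$. *)

theory Defs
  imports Complex_Main "HOL-Algebra.Algebra" "Jordan_Normal_Form.DL_Rank"
begin

definition nonprincipal_ultrafilter :: "nat filter \<Rightarrow> bool" where
  "nonprincipal_ultrafilter \<omega> \<longleftrightarrow>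
     \<omega> \<noteq> bot \<and> (\<forall>P. eventually P \<omega> \<or> eventually (\<lambda>x. \<not> P x) \<omega>) \<and> \<omega> \<le> cofinite"

definition rho :: "nat \<Rightarrow> complex mat \<Rightarrow> real" where
  "rho n A = real (vec_space.rank n A) / real n"

definition GLprod :: "(nat \<Rightarrow> nat) \<Rightarrow> (nat \<Rightarrow> complex mat) monoid" where
  "GLprod n = \<lparr> carrier = {a. \<forall>k. a k \<in> carrier_mat (n k) (n k) \<and> invertible_mat (a k)},
                monoid.mult = (\<lambda>a b k. a k * b k),
                monoid.one = (\<lambda>k. 1\<^sub>m (n k)) \<rparr>"

definition rank_null :: "nat filter \<Rightarrow> (nat \<Rightarrow> nat) \<Rightarrow> (nat \<Rightarrow> complex mat) set" where
  "rank_null \<omega> n = {a \<in> carrier (GLprod n).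
      ((\<lambda>k. rho (n k) (a k - 1\<^sub>m (n k))) \<longlongrightarrow> 0) \<omega>}"

definition GL_ultraproduct :: "nat filter \<Rightarrow> (nat \<Rightarrow> nat) \<Rightarrow> (nat \<Rightarrow> complex mat) set monoid" where
  "GL_ultraproduct \<omega> n = GLprod n Mod rank_null \<omega> n"

definition linear_sofic :: "('a, 'b) monoid_scheme \<Rightarrow> bool" where
  "linear_sofic G \<longleftrightarrow>
     (\<exists>\<omega> n f. nonprincipal_ultrafilter \<omega> \<and> filterlim n at_top sequentially \<and>
        f \<in> hom G (GL_ultraproduct \<omega> n) \<and> inj_on f (carrier G))"

definition amenable :: "('a, 'b) monoid_scheme \<Rightarrow> bool" where
  "amenable G \<longleftrightarrow>
     (\<exists>\<mu> :: 'a set \<Rightarrow> real.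
        (\<forall>A. A \<subseteq> carrier G \<longrightarrow> \<mu> A \<ge> 0) \<and>
        \<mu> (carrier G) = 1 \<and>
        (\<forall>A B. A \<subseteq> carrier G \<longrightarrow> B \<subseteq> carrier G \<longrightarrow> A \<inter> B = {} \<longrightarrow>
                \<mu> (A \<union> B) = \<mu> A + \<mu> B) \<and>
        (\<forall>g \<in> carrier G. \<forall>A. A \<subseteq> carrier G \<longrightarrow> \<mu> (g <#\<^bsub>G\<^esub> A) = \<mu> A))"

end

theory Submission
  imports Defs
begin

text \<open>Linear soficity amounts to almost multiplicative maps into \<open>GL\<^sub>n\<close> on finite sets, with a bound
  \<open>rank (\<phi> g - 1) \<ge> \<delta> g * n\<close> for some \<open>\<delta> g > 0\<close>. Given such maps \<open>\<phi>\<close> on \<open>H\<close>, one induces from \<open>H\<close> to \<open>G\<close>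
  along a Foelner set \<open>S\<close> of \<open>G/H\<close>. The coset \<open>t\<close> contributes a conjugate of \<open>\<phi> h\<close> by its
  representative, for which \<open>\<delta>\<close> is not uniformly bounded below. Inducing instead the tensor product over
  \<open>u \<in> S\<close> of \<open>1 \<oplus> \<phi> (u h u\<inverse>)\<close> makes \<open>\<phi> h\<close> itself a factor of every diagonal block, and the summand
  \<open>1\<close> guarantees that the other factors cannot cancel it, so at least half of \<open>\<delta> h\<close> survives.
  Elements outside \<open>H\<close> move every coset, so they are far from the identity.
  Foelner sets come from the invariant mean: without them some finite set doubles every finite set,
  and Hall's theorem gives a paradoxical decomposition.\<close>

section \<open>Foelner sets\<close>

text \<open>The conjugates of \<open>h\<close> met in the induction are indexed by a Foelner set
  that grows with the required precision, so a minimum of \<delta> over them could tend to 0. A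
  tensor product without trivial summands can collapse: if \<open>P\<close> and the product
  \<open>Q\<close> of the other factors are mutually inverse scalars, \<open>P \<otimes> Q\<close>
  is the identity although \<open>P\<close> is far from it. The price of the summand is that each
  factor acts on dimension \<open>2 * N\<close> instead of \<open>N\<close>, whence \<delta> / 2.
  The huge dimension is harmless because ranks are measured relative to it: exchanging one tensor
  factor costs the same proportion of the dimension as in that factor alone, so the defect is
  multiplied at most by the number of cosets. This is why the Foelner set is fixed first and the map
  on \<open>H\<close> is chosen afterwards. The constant 1/6 outside \<open>H\<close> is 1/2 times
  1/3: at least half of the cosets stay inside the Foelner set, and a third of those can be
  separated from their translates.\<close>

text \<open>Rado's proof: in a minimal family of sets satisfying Hall's condition every set is a singleton,
  since removing either of two elements of the same set would keep the condition.\<close>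

lemma hall_infinite:
  fixes N :: "'a \<Rightarrow> 'b set"
  assumes fin: "\<And>a. a \<in> A \<Longrightarrow> finite (N a)"
    and hall: "\<And>I. finite I \<Longrightarrow> I \<subseteq> A \<Longrightarrow> card I \<le> card (\<Union>a\<in>I. N a)"
  obtains m where "inj_on m A" "\<And>a. a \<in> A \<Longrightarrow> m a \<in> N a"
proof -
  \<comment> \<open>\<open>D\<close> collects the deleted pairs, so minimal families correspond to
    maximal \<open>D\<close> and Zorn's lemma applies to inclusion.\<close>
  define M where "M D a = N a - D `` {a}" for D :: "('a \<times> 'b) set" and a
  define hc where "hc D \<longleftrightarrow> (\<forall>I. finite I \<longrightarrow> I \<subseteq> A \<longrightarrow> card I \<le> card (\<Union>a\<in>I. M D a))" for D
  have finM: "finite (\<Union>a\<in>I. M D a)" if "finite I" "I \<subseteq> A" for I D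
    using that fin unfolding M_def by blast
  have "\<exists>Y\<in>Collect hc. \<forall>Z\<in>Collect hc. Y \<subseteq> Z \<longrightarrow> Z = Y"
  proof (rule subset_Zorn_nonempty)
    have "hc {}" using hall by (simp add: hc_def M_def)
    then show "Collect hc \<noteq> {}" by blast
  next
    fix C assume C: "C \<noteq> {}" "subset.chain (Collect hc) C"
    have "hc (\<Union>C)" unfolding hc_def
    proof (intro allI impI)
      fix I assume I: "finite I" "I \<subseteq> A"
      \<comment> \<open>Hall's condition at a finite \<open>I\<close> involves only finitely many
        pairs, so one member of the chain already makes all the deletions that \<open>I\<close>
        sees.\<close>
      have "finite (\<Union>C \<inter> Sigma I N)"
        by (rule finite_subset[of _ "Sigma I N"]) (use I fin in auto)
      then obtain D where D: "D \<in> C" "\<Union>C \<inter> Sigma I N \<subseteq> D"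
        using finite_subset_Union_chain[of "\<Union>C \<inter> Sigma I N" C "Collect hc"] C by blast
      have "(\<Union>a\<in>I. M D a) = (\<Union>a\<in>I. M (\<Union>C) a)"
        using D by (auto simp: M_def)
      moreover have "hc D" using C(2) D(1) by (auto simp: subset.chain_def)
      ultimately show "card I \<le> card (\<Union>a\<in>I. M (\<Union>C) a)"
        using I by (metis hc_def)
    qed
    then show "\<Union>C \<in> Collect hc" by simp
  qed
  then obtain D where D: "hc D" "\<And>Z. hc Z \<Longrightarrow> D \<subseteq> Z \<Longrightarrow> Z = D" by blast
  \<comment> \<open>By maximality of \<open>D\<close>, deleting \<open>(a, x)\<close> violates
    Hall's condition at some finite set. That set must contain \<open>a\<close>; the witness is the
    set with \<open>a\<close> removed, which turns the strict inequality into a weak one.\<close>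
  have shrink: "\<exists>I. finite I \<and> I \<subseteq> A \<and> a \<notin> I \<and> card ((\<Union>b\<in>I. M D b) \<union> (M D a - {x})) \<le> card I"
    if a: "a \<in> A" and x: "x \<in> M D a" for a x
  proof -
    have "\<not> hc (insert (a, x) D)"
      using D(2)[of "insert (a, x) D"] x by (auto simp: M_def)
    then obtain I where I: "finite I" "I \<subseteq> A"
      and lt: "card (\<Union>b\<in>I. M (insert (a, x) D) b) < card I"
      by (auto simp: hc_def not_le)
    have "a \<in> I"
    proof (rule ccontr)
      assume "a \<notin> I"
      then have "(\<Union>b\<in>I. M (insert (a, x) D) b) = (\<Union>b\<in>I. M D b)"
        by (intro SUP_cong) (auto simp: M_def)
      then show False using lt D(1) I by (auto simp: hc_def not_le[symmetric])
    qed
    then have "(\<Union>b\<in>I. M (insert (a, x) D) b) = (\<Union>b\<in>I - {a}. M D b) \<union> (M D a - {x})"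
      by (auto simp: M_def)
    then have "card ((\<Union>b\<in>I - {a}. M D b) \<union> (M D a - {x})) \<le> card (I - {a})"
      using lt I \<open>a \<in> I\<close> by (simp add: card_Diff_singleton)
    then show ?thesis using I by (intro exI[of _ "I - {a}"]) auto
  qed
  have uniq: "x = y" if a: "a \<in> A" and x: "x \<in> M D a" and y: "y \<in> M D a" for a x y
  proof (rule ccontr)
    assume "x \<noteq> y"
    obtain I where I: "finite I" "I \<subseteq> A" "a \<notin> I"
      "card ((\<Union>b\<in>I. M D b) \<union> (M D a - {x})) \<le> card I" (is "card ?U \<le> _")
      using shrink[OF a x] by blast
    obtain J where J: "finite J" "J \<subseteq> A" "a \<notin> J"
      "card ((\<Union>b\<in>J. M D b) \<union> (M D a - {y})) \<le> card J" (is "card ?V \<le> _")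
      using shrink[OF a y] by blast
    have fM: "finite (M D a)" using fin[OF a] by (simp add: M_def)
    have fU: "finite ?U" "finite ?V" using finM I J fM by auto
    have un: "?U \<union> ?V = (\<Union>b\<in>insert a (I \<union> J). M D b)" using \<open>x \<noteq> y\<close> by auto
    \<comment> \<open>The two witnesses play against each other: \<open>?U \<union> ?V\<close> has
      at least \<open>card (I \<union> J) + 1\<close> elements and \<open>?U \<inter> ?V\<close> at
      least \<open>card (I \<inter> J)\<close>, while their sizes add up to at most
      \<open>card I + card J\<close>.\<close>
    have "card (insert a (I \<union> J)) \<le> card (?U \<union> ?V)"
      unfolding un using D(1)[unfolded hc_def, rule_format, of "insert a (I \<union> J)"] I(1,2) J(1,2) a by simp
    moreover have "card (I \<inter> J) \<le> card (\<Union>b\<in>I \<inter> J. M D b)"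
      using D(1)[unfolded hc_def, rule_format, of "I \<inter> J"] I(1,2) J(1,2) by blast
    moreover have "card (\<Union>b\<in>I \<inter> J. M D b) \<le> card (?U \<inter> ?V)"
      by (rule card_mono) (use fU in auto)
    moreover have "card (insert a (I \<union> J)) = Suc (card (I \<union> J))" using I J by simp
    moreover have "card I + card J = card (I \<union> J) + card (I \<inter> J)"
      using I J by (intro card_Un_Int)
    moreover have "card ?U + card ?V = card (?U \<union> ?V) + card (?U \<inter> ?V)"
      using fU by (intro card_Un_Int)
    ultimately show False using I(4) J(4) by linarith
  qed
  have ne: "M D a \<noteq> {}" if "a \<in> A" for a
    using D(1) that unfolding hc_def by (auto dest!: spec[of _ "{a}"])
  define m where "m a = (SOME x. x \<in> M D a)" for a
  have m: "m a \<in> M D a" if "a \<in> A" for a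
    unfolding m_def using ne[OF that] by (simp add: some_in_eq)
  have "inj_on m A"
  proof (rule inj_onI, rule ccontr)
    fix a b assume ab: "a \<in> A" "b \<in> A" "m a = m b" "a \<noteq> b"
    have "M D a \<subseteq> {m a}" "M D b \<subseteq> {m b}" using m uniq ab(1,2) by blast+
    then have "(\<Union>c\<in>{a,b}. M D c) \<subseteq> {m a}" using ab(3) by auto
    then have "card (\<Union>c\<in>{a,b}. M D c) \<le> 1" using card_mono[of "{m a}"] by fastforce
    moreover have "card {a,b} \<le> card (\<Union>c\<in>{a,b}. M D c)"
      using D(1)[unfolded hc_def, rule_format, of "{a, b}"] ab(1,2) by simp
    ultimately show False using ab by simp
  qed
  then show ?thesis using m that[of m] by (auto simp: M_def)
qed

section \<open>Invariant means and Foelner sets\<close>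

context group begin

lemma finite_translates:
  assumes "finite E" "finite S" shows "finite (E <#> S)"
  using assms by (simp add: set_mult_def)

text \<open>Were every finite set at least doubled by \<open>E\<close>, Hall's theorem would inject
  two copies of the group into one, moving each point by a left factor from \<open>E\<close>.
  Sorting points by that factor gives a paradoxical decomposition, and the mean would have to
  satisfy 2 \<le> 1.\<close>

lemma no_doubling_if_amenable:
  assumes am: "amenable G" and E: "finite E" "E \<subseteq> carrier G"
  shows "\<exists>S. finite S \<and> S \<subseteq> carrier G \<and> S \<noteq> {} \<and> card (E <#> S) < 2 * card S"
proof (rule ccontr)
  assume no: "\<not> ?thesis"
  have dbl: "2 * card S \<le> card (E <#> S)" if "finite S" "S \<subseteq> carrier G" for S
    using no that by (cases "S = {}") (auto simp: not_less)
  obtain m where m: "inj_on m (carrier G \<times> (UNIV :: bool set))"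
    "\<And>a. a \<in> carrier G \<times> (UNIV :: bool set) \<Longrightarrow> m a \<in> (\<lambda>e. e \<otimes> fst a) ` E"
  proof (rule hall_infinite[of "carrier G \<times> (UNIV :: bool set)" "\<lambda>a. (\<lambda>e. e \<otimes> fst a) ` E"])
    fix I assume I: "finite I" "I \<subseteq> carrier G \<times> (UNIV :: bool set)"
    \<comment> \<open>Completing \<open>I\<close> to full fibres over its projection can only
      increase the left side and leaves the neighbourhood unchanged, so doubling is Hall's
      condition.\<close>
    have "card I \<le> card (fst ` I \<times> (UNIV :: bool set))"
    proof (rule card_mono)
      show "I \<subseteq> fst ` I \<times> UNIV" by force
    qed (use I in auto)
    also have "\<dots> = 2 * card (fst ` I)" by (simp add: card_cartesian_product)
    also have "\<dots> \<le> card (E <#> fst ` I)" by (rule dbl) (use I in auto)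
    also have "E <#> fst ` I = (\<Union>a\<in>I. (\<lambda>e. e \<otimes> fst a) ` E)" by (auto simp: set_mult_def)
    finally show "card I \<le> card (\<Union>a\<in>I. (\<lambda>e. e \<otimes> fst a) ` E)" .
  qed (use E in auto)
  obtain \<mu> :: "'a set \<Rightarrow> real" where mu:
    "\<forall>A. A \<subseteq> carrier G \<longrightarrow> \<mu> A \<ge> 0"
    "\<mu> (carrier G) = 1"
    "\<forall>A B. A \<subseteq> carrier G \<longrightarrow> B \<subseteq> carrier G \<longrightarrow> A \<inter> B = {} \<longrightarrow>
                \<mu> (A \<union> B) = \<mu> A + \<mu> B"
    "\<forall>g \<in> carrier G. \<forall>A. A \<subseteq> carrier G \<longrightarrow> \<mu> (g <#\<^bsub>G\<^esub> A) = \<mu> A"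
    using am unfolding amenable_def by (elim exE conjE)
  note pos = mu(1)[rule_format] and one = mu(2) and add = mu(3)[rule_format] and inv = mu(4)[rule_format]
  have mu0: "\<mu> {} = 0" using add[of "{}" "{}"] by simp
  have sum: "\<mu> (\<Union>i\<in>J. B i) = (\<Sum>i\<in>J. \<mu> (B i))"
    if "finite J" "\<And>i. i \<in> J \<Longrightarrow> B i \<subseteq> carrier G" "\<And>i j. i \<in> J \<Longrightarrow> j \<in> J \<Longrightarrow> i \<noteq> j \<Longrightarrow> B i \<inter> B j = {}"
    for J :: "('a \<times> bool) set" and B
    using that
  proof (induction J rule: finite_induct)
    case empty then show ?case by (simp add: mu0)
  next
    case (insert j J)
    have "\<mu> (B j \<union> (\<Union>i\<in>J. B i)) = \<mu> (B j) + \<mu> (\<Union>i\<in>J. B i)"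
    proof (rule add)
      show "B j \<inter> (\<Union>i\<in>J. B i) = {}" using insert.hyps insert.prems(2)[of j] by blast
    qed (use insert.prems(1) in auto)
    then show ?case using insert by simp
  qed
  \<comment> \<open>\<open>P (e, i)\<close> consists of the points of copy \<open>i\<close> that
    \<open>m\<close> multiplies by \<open>e\<close>. For fixed \<open>i\<close> these sets cover the
    group disjointly, and their translates by \<open>e\<close> are disjoint over all
    \<open>(e, i)\<close>, being images of disjoint sets under the injective
    \<open>m\<close>.\<close>
  define P where "P = (\<lambda>(e, i). {q \<in> carrier G. m (q, i) = e \<otimes> q})"
  have Psub: "P a \<subseteq> carrier G" for a by (auto simp: P_def split: prod.splits)
  have sum1: "(\<Sum>e\<in>E. \<mu> (P (e, i))) = 1" for i
  proof -
    have "(\<Union>a\<in>E \<times> {i}. P a) = carrier G"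
      using m(2)[of "(_, i)"] by (auto simp: P_def)
    then have "1 = (\<Sum>a\<in>E \<times> {i}. \<mu> (P a))"
    proof (subst sum[symmetric])
      show "P a \<inter> P b = {}" if "a \<in> E \<times> {i}" "b \<in> E \<times> {i}" "a \<noteq> b" for a b
      proof (rule ccontr)
        assume "P a \<inter> P b \<noteq> {}"
        then obtain q where "q \<in> P a" "q \<in> P b" by blast
        with that E show False by (auto simp: P_def subset_iff)
      qed
    qed (use one E Psub in auto)
    also have "\<dots> = (\<Sum>e\<in>E. \<mu> (P (e, i)))"
      by (rule sum.reindex_bij_witness[of _ "\<lambda>e. (e, i)" fst]) auto
    finally show ?thesis by simp
  qed
  have mem: "m (q, snd a) = fst a \<otimes> q \<and> q \<in> carrier G" if "q \<in> P a" for q a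
    using that by (auto simp: P_def split: prod.splits)
  have "(\<Sum>a\<in>E \<times> UNIV. \<mu> (fst a <#\<^bsub>G\<^esub> P a)) = \<mu> (\<Union>a\<in>E \<times> UNIV. fst a <#\<^bsub>G\<^esub> P a)"
  proof (rule sum[symmetric])
    fix a b assume ab: "a \<in> E \<times> (UNIV::bool set)" "b \<in> E \<times> (UNIV::bool set)" "a \<noteq> b"
    show "(fst a <#\<^bsub>G\<^esub> P a) \<inter> (fst b <#\<^bsub>G\<^esub> P b) = {}"
    proof (rule ccontr)
      assume "\<not> ?thesis"
      then obtain p q where pq: "p \<in> P a" "q \<in> P b" "fst a \<otimes> p = fst b \<otimes> q"
        by (auto simp: l_coset_def)
      then have "m (p, snd a) = m (q, snd b)" using mem by metis
      moreover have pc: "p \<in> carrier G" "q \<in> carrier G" using pq mem by blast+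
      ultimately have *: "p = q" "snd a = snd b"
        using m(1) by (auto dest!: inj_onD)
      have "fst a \<in> carrier G" "fst b \<in> carrier G" using ab E by auto
      then have "fst a = fst b" using pq(3) pc * by simp
      then have "a = b" using *(2) by (rule prod_eqI)
      then show False using ab by simp
    qed
  next
    fix a assume "a \<in> E \<times> (UNIV::bool set)"
    then show "fst a <#\<^bsub>G\<^esub> P a \<subseteq> carrier G" using E Psub[of a] by (intro l_coset_subset_G) auto
  qed (use E in auto)
  also have "\<dots> \<le> 1"
  proof -
    let ?U = "\<Union>a\<in>E \<times> (UNIV::bool set). fst a <#\<^bsub>G\<^esub> P a"
    have U: "?U \<subseteq> carrier G"
      by (intro UN_least l_coset_subset_G Psub) (use E in auto)
    then have "\<mu> ?U + \<mu> (carrier G - ?U) = \<mu> (?U \<union> (carrier G - ?U))" by (intro add[symmetric]) auto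
    also have "?U \<union> (carrier G - ?U) = carrier G" using U by blast
    finally show ?thesis using pos[of "carrier G - ?U"] one by auto
  qed
  also have "(\<Sum>a\<in>E \<times> UNIV. \<mu> (fst a <#\<^bsub>G\<^esub> P a)) = (\<Sum>a\<in>E \<times> UNIV. \<mu> (P a))"
    by (rule sum.cong) (use E inv Psub in auto)
  also have "\<dots> = (\<Sum>e\<in>E. \<Sum>i\<in>UNIV. \<mu> (P (e, i)))" by (simp add: sum.cartesian_product)
  also have "\<dots> = (\<Sum>i\<in>UNIV. \<Sum>e\<in>E. \<mu> (P (e, i)))" by (rule sum.swap)
  also have "\<dots> = 2" by (simp add: sum1 UNIV_bool)
  finally show False by simp
qed

text \<open>Without such an \<open>S\<close> every finite set grows by the factor
  \<open>1 + \<epsilon>\<close> under multiplication by \<open>K\<close> with the identity adjoined;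
  a high power of that set then doubles every finite set, against
  \<open>no_doubling_if_amenable\<close>.\<close>

lemma folner_if_amenable:
  fixes \<epsilon> :: real
  assumes am: "amenable G" and K: "finite K" "K \<subseteq> carrier G" and eps: "\<epsilon> > 0"
  obtains S where "finite S" "S \<subseteq> carrier G" "S \<noteq> {}"
    "\<And>k. k \<in> K \<Longrightarrow> card ((k <#\<^bsub>G\<^esub> S) - S) \<le> \<epsilon> * card S"
proof (rule ccontr)
  note witness = that
  assume "\<not> thesis"
  then have no: "\<exists>k\<in>K. card ((k <#\<^bsub>G\<^esub> S) - S) > \<epsilon> * card S"
    if S: "finite S" "S \<subseteq> carrier G" "S \<noteq> {}" for S
    using S \<open>\<not> thesis\<close> witness[of S] by (force simp: not_le)
  define E where "E = insert \<one> K"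
  have E: "finite E" "E \<subseteq> carrier G" "\<one> \<in> E" using K by (auto simp: E_def)
  have grow: "card (E <#> S) \<ge> (1 + \<epsilon>) * card S" if S: "finite S" "S \<subseteq> carrier G" for S
  proof (cases "S = {}")
    case False
    obtain k where k: "k \<in> K" "card ((k <#\<^bsub>G\<^esub> S) - S) > \<epsilon> * card S" using no[OF S False] by blast
    \<comment> \<open>The identity in \<open>E\<close> keeps \<open>S\<close> itself, so the new
      elements of one translate are a genuine gain.\<close>
    have "S \<union> ((k <#\<^bsub>G\<^esub> S) - S) \<subseteq> E <#> S"
      using k(1) S unfolding E_def set_mult_def l_coset_def by force
    then have "card (S \<union> ((k <#\<^bsub>G\<^esub> S) - S)) \<le> card (E <#> S)"
      using E S finite_translates by (intro card_mono) auto
    moreover have "card (S \<union> ((k <#\<^bsub>G\<^esub> S) - S)) = card S + card ((k <#\<^bsub>G\<^esub> S) - S)"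
      using S by (intro card_Un_disjoint) (auto simp: l_coset_def)
    ultimately show ?thesis using k by (simp add: algebra_simps)
  qed simp
  define T where "T n = ((\<lambda>Z. E <#> Z) ^^ n) {\<one>}" for n
  have T: "finite (T n) \<and> T n \<subseteq> carrier G" for n
    by (induction n) (use E finite_translates in \<open>auto simp: T_def set_mult_def subset_iff\<close>)
  have powr: "card (T n <#> S) \<ge> (1 + \<epsilon>) ^ n * card S" if S: "finite S" "S \<subseteq> carrier G" for S n
  proof (induction n)
    case 0
    have "T 0 <#> S = S" using S by (force simp: T_def set_mult_def)
    then show ?case by simp
  next
    case (Suc n)
    have "T (Suc n) <#> S = E <#> (T n <#> S)"
      using E T[of n] S by (simp add: T_def set_mult_assoc)
    then have "card (T (Suc n) <#> S) \<ge> (1 + \<epsilon>) * card (T n <#> S)"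
      using grow[of "T n <#> S"] T[of n] S finite_translates set_mult_closed by simp
    moreover have "(1 + \<epsilon>) * card (T n <#> S) \<ge> (1 + \<epsilon>) * ((1 + \<epsilon>) ^ n * card S)"
      using Suc eps by (intro mult_left_mono) auto
    ultimately show ?case unfolding power_Suc mult.assoc by linarith
  qed
  \<comment> \<open>Iterated growth beats the factor 2, and the \<open>n\<close>-fold product set
    \<open>T n\<close> is a single finite set to which the doubling lemma applies.\<close>
  obtain n where n: "(1 + \<epsilon>) ^ n > 2"
    using real_arch_pow[of "1 + \<epsilon>" 2] eps by auto
  obtain S where S: "finite S" "S \<subseteq> carrier G" "S \<noteq> {}" "card (T n <#> S) < 2 * card S"
    using no_doubling_if_amenable[OF am, of "T n"] T by blast
  have "2 * real (card S) \<le> (1 + \<epsilon>) ^ n * card S"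
    using n by (intro mult_right_mono) auto
  also have "\<dots> \<le> card (T n <#> S)" by (rule powr[OF S(1,2)])
  finally show False using S(4) by simp
qed

end


section \<open>Ranks of matrices indexed by finite sets\<close>

definition matmul :: "'y set \<Rightarrow> ('x \<Rightarrow> 'y \<Rightarrow> complex) \<Rightarrow> ('y \<Rightarrow> 'z \<Rightarrow> complex) \<Rightarrow> 'x \<Rightarrow> 'z \<Rightarrow> complex" where
  "matmul Y A B = (\<lambda>x z. \<Sum>y\<in>Y. A x y * B y z)"

definition id_fun_mat :: "'x \<Rightarrow> 'x \<Rightarrow> complex" where
  "id_fun_mat x y = (if x = y then 1 else 0)"

text \<open>Factorization through an \<open>r\<close>-dimensional space. Arbitrary index sets are
  allowed because the matrices below are indexed by pairs and tuples.\<close>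

definition rank_le :: "'x set \<Rightarrow> 'y set \<Rightarrow> ('x \<Rightarrow> 'y \<Rightarrow> complex) \<Rightarrow> nat \<Rightarrow> bool" where
  "rank_le Xs Y A r \<longleftrightarrow> (\<exists>B C. \<forall>x\<in>Xs. \<forall>y\<in>Y. A x y = (\<Sum>i<r. B x i * C i y))"

text \<open>The dual certificate: some compression of the matrix is the identity of size
  \<open>r\<close>. Having witnesses for lower bounds as well lets them be assembled
  blockwise.\<close>

definition rank_ge :: "'x set \<Rightarrow> 'y set \<Rightarrow> ('x \<Rightarrow> 'y \<Rightarrow> complex) \<Rightarrow> nat \<Rightarrow> bool" where
  "rank_ge Xs Y A r \<longleftrightarrow> (\<exists>U V. \<forall>i<r. \<forall>j<r.
     (\<Sum>x\<in>Xs. \<Sum>y\<in>Y. U i x * A x y * V y j) = id_fun_mat i j)"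

lemma id_fun_mat_sum [simp]:
  "finite Xs \<Longrightarrow> (\<Sum>y\<in>Xs. id_fun_mat x y * f y) = (if x \<in> Xs then f x else 0)"
  "finite Xs \<Longrightarrow> (\<Sum>y\<in>Xs. f y * id_fun_mat y x) = (if x \<in> Xs then f x else 0)"
  "finite Xs \<Longrightarrow> (\<Sum>y\<in>Xs. id_fun_mat y x * f y) = (if x \<in> Xs then f x else 0)"
  "finite Xs \<Longrightarrow> (\<Sum>y\<in>Xs. f y * id_fun_mat x y) = (if x \<in> Xs then f x else 0)"
  by (auto simp: id_fun_mat_def if_distrib[of "\<lambda>t. t * _"] if_distrib[of "\<lambda>t. _ * t"] cong: if_cong)

text \<open>Lets pairs, tuples or disjoint sums serve as inner index; missing indices up to
  \<open>r\<close> are filled with zeros.\<close>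

lemma rank_le_index_set:
  assumes "finite I" "card I \<le> r"
    and "\<And>x y. x \<in> Xs \<Longrightarrow> y \<in> Y \<Longrightarrow> A x y = (\<Sum>i\<in>I. B x i * C i y)"
  shows "rank_le Xs Y A r"
proof -
  obtain h where h: "bij_betw h {..<card I} I"
    using ex_bij_betw_nat_finite[OF assms(1)] by (auto simp: atLeast0LessThan)
  show ?thesis unfolding rank_le_def
  proof (intro exI ballI)
    fix x y assume xy: "x \<in> Xs" "y \<in> Y"
    have "A x y = (\<Sum>i<card I. B x (h i) * C (h i) y)"
      using assms(3)[OF xy] sum.reindex_bij_betw[OF h, of "\<lambda>i. B x i * C i y"] by simp
    also have "\<dots> = (\<Sum>i<r. (if i < card I then B x (h i) else 0) * C (h i) y)"
      using assms(2) by (intro sum.mono_neutral_cong_left) auto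
    finally show "A x y = (\<Sum>i<r. (if i < card I then B x (h i) else 0) * C (h i) y)" .
  qed
qed

lemma rank_le_mono: "rank_le Xs Y A r \<Longrightarrow> r \<le> s \<Longrightarrow> rank_le Xs Y A s"
  unfolding rank_le_def[of _ _ _ r] by (elim exE) (rule rank_le_index_set[of "{..<r}"], auto)

lemma rank_le_cong:
  "rank_le Xs Y A r \<Longrightarrow> (\<And>x y. x \<in> Xs \<Longrightarrow> y \<in> Y \<Longrightarrow> A x y = B x y) \<Longrightarrow> rank_le Xs Y B r"
  unfolding rank_le_def by simp

lemma rank_le_card_cols: "finite Y \<Longrightarrow> rank_le Xs Y A (card Y)"
  by (rule rank_le_index_set[of Y _ _ _ _ A id_fun_mat]) auto

lemma rank_le_add:
  assumes "rank_le Xs Y A r" "rank_le Xs Y B s"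
  shows "rank_le Xs Y (\<lambda>x y. A x y + B x y) (r + s)"
proof -
  obtain P Q where A: "\<forall>x\<in>Xs. \<forall>y\<in>Y. A x y = (\<Sum>i<r. P x i * Q i y)"
    using assms(1) unfolding rank_le_def by (elim exE)
  obtain P' Q' where B: "\<forall>x\<in>Xs. \<forall>y\<in>Y. B x y = (\<Sum>i<s. P' x i * Q' i y)"
    using assms(2) unfolding rank_le_def by (elim exE)
  show ?thesis
    by (rule rank_le_index_set[of "{..<r} <+> {..<s}" _ _ _ _
          "\<lambda>x. case_sum (P x) (P' x)" "\<lambda>i y. case_sum (\<lambda>i. Q i y) (\<lambda>i. Q' i y) i"])
       (simp_all add: A B sum.Plus card_Plus)
qed

lemma rank_le_sum:
  assumes "finite J" "\<And>j. j \<in> J \<Longrightarrow> rank_le Xs Y (A j) (r j)"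
  shows "rank_le Xs Y (\<lambda>x y. \<Sum>j\<in>J. A j x y) (\<Sum>j\<in>J. r j)"
  using assms
proof (induction J rule: finite_induct)
  case empty then show ?case by (simp add: rank_le_def)
next
  case (insert j J)
  then show ?case using rank_le_add[of Xs Y "A j" "r j"] by simp
qed

lemma rank_le_matmul_left:
  assumes "rank_le Y Z A r"
  shows "rank_le Xs Z (matmul Y P A) r"
proof -
  obtain B C where *: "\<forall>x\<in>Y. \<forall>y\<in>Z. A x y = (\<Sum>i<r. B x i * C i y)"
    using assms unfolding rank_le_def by (elim exE)
  show ?thesis
  proof (rule rank_le_index_set[of "{..<r}" _ _ _ _ "\<lambda>x i. \<Sum>y\<in>Y. P x y * B y i" C])
    fix x z assume "z \<in> Z"
    then have "matmul Y P A x z = (\<Sum>y\<in>Y. \<Sum>i<r. P x y * B y i * C i z)"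
      unfolding matmul_def by (intro sum.cong) (auto simp: * sum_distrib_left mult.assoc)
    also have "\<dots> = (\<Sum>i<r. (\<Sum>y\<in>Y. P x y * B y i) * C i z)"
      by (subst sum.swap) (simp add: sum_distrib_right)
    finally show "matmul Y P A x z = (\<Sum>i<r. (\<Sum>y\<in>Y. P x y * B y i) * C i z)" .
  qed auto
qed

lemma rank_le_matmul_right:
  assumes "rank_le Xs Y A r"
  shows "rank_le Xs Z (matmul Y A P) r"
proof -
  obtain B C where *: "\<forall>x\<in>Xs. \<forall>y\<in>Y. A x y = (\<Sum>i<r. B x i * C i y)"
    using assms unfolding rank_le_def by (elim exE)
  show ?thesis
  proof (rule rank_le_index_set[of "{..<r}" _ _ _ _ B "\<lambda>i z. \<Sum>y\<in>Y. C i y * P y z"])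
    fix x z assume "x \<in> Xs"
    then have "matmul Y A P x z = (\<Sum>y\<in>Y. \<Sum>i<r. B x i * (C i y * P y z))"
      unfolding matmul_def by (intro sum.cong) (auto simp: * sum_distrib_right mult.assoc)
    also have "\<dots> = (\<Sum>i<r. B x i * (\<Sum>y\<in>Y. C i y * P y z))"
      by (subst sum.swap) (simp add: sum_distrib_left)
    finally show "matmul Y A P x z = (\<Sum>i<r. B x i * (\<Sum>y\<in>Y. C i y * P y z))" .
  qed auto
qed

text \<open>If \<open>s < r\<close>, padding makes the factors square with column \<open>s\<close>
  of the left one equal to zero. One-sided inverses of square matrices are two-sided, so the entry
  \<open>(s, s)\<close> of the reversed product would be both 1 and 0.\<close>

lemma rank_le_identity:
  assumes "rank_le {..<r} {..<r} (id_fun_mat :: nat \<Rightarrow> nat \<Rightarrow> complex) s"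
  shows "r \<le> s"
proof (rule ccontr)
  assume "\<not> r \<le> s"
  obtain B C :: "nat \<Rightarrow> nat \<Rightarrow> complex" where
    BC: "\<forall>x\<in>{..<r}. \<forall>y\<in>{..<r}. id_fun_mat x y = (\<Sum>i<s. B x i * C i y)"
    using assms unfolding rank_le_def by (elim exE)
  have *: "id_fun_mat x y = (\<Sum>i<s. B x i * C i y)" if "x < r" "y < r" for x y
    using BC that by simp
  define M where "M = mat r r (\<lambda>(i, j). if j < s then B i j else 0)"
  define N where "N = mat r r (\<lambda>(i, j). C i j)"
  have MN: "M \<in> carrier_mat r r" "N \<in> carrier_mat r r" by (auto simp: M_def N_def)
  have "M * N = 1\<^sub>m r"
  proof (rule eq_matI)
    fix i j assume "i < dim_row (1\<^sub>m r :: complex mat)" "j < dim_col (1\<^sub>m r :: complex mat)"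
    then have ij: "i < r" "j < r" by auto
    have "(M * N) $$ (i, j) = (\<Sum>k<r. (if k < s then B i k else 0) * C k j)"
      using ij by (auto simp: M_def N_def scalar_prod_def atLeast0LessThan intro!: sum.cong)
    also have "\<dots> = (\<Sum>k<s. B i k * C k j)"
      using \<open>\<not> r \<le> s\<close> by (intro sum.mono_neutral_cong_right) auto
    also have "\<dots> = id_fun_mat i j" using *[OF ij] by simp
    finally show "(M * N) $$ (i, j) = 1\<^sub>m r $$ (i, j)" using ij by (simp add: id_fun_mat_def)
  qed (auto simp: M_def N_def)
  then have "N * M = 1\<^sub>m r" using mat_mult_left_right_inverse[OF MN] by simp
  then have "(N * M) $$ (s, s) = 1" using \<open>\<not> r \<le> s\<close> by simp
  moreover have "(N * M) $$ (s, s) = 0"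
    using \<open>\<not> r \<le> s\<close> by (auto simp: M_def N_def scalar_prod_def)
  ultimately show False by simp
qed

text \<open>Compressing a factorization of size \<open>s\<close> to the identity of size
  \<open>r\<close> factors that identity through dimension \<open>s\<close>.\<close>

lemma rank_ge_le_rank_le:
  assumes "rank_ge Xs Y A r" "rank_le Xs Y A s"
  shows "r \<le> s"
proof (rule rank_le_identity)
  obtain U V where UV: "\<forall>i<r. \<forall>j<r. (\<Sum>x\<in>Xs. \<Sum>y\<in>Y. U i x * A x y * V y j) = id_fun_mat i j"
    using assms(1) unfolding rank_ge_def by (elim exE)
  note * = UV[rule_format]
  have "rank_le {..<r} {..<r} (matmul Xs U (matmul Y A V)) s"
    by (intro rank_le_matmul_left rank_le_matmul_right assms)
  then show "rank_le {..<r} {..<r} (id_fun_mat :: nat \<Rightarrow> nat \<Rightarrow> complex) s"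
    by (rule rank_le_cong) (simp add: matmul_def sum_distrib_left mult.assoc *[symmetric])
qed

lemma rank_ge_index_set:
  assumes "finite R" "r \<le> card R"
    and *: "\<And>i j. i \<in> R \<Longrightarrow> j \<in> R \<Longrightarrow>
      (\<Sum>x\<in>Xs. \<Sum>y\<in>Y. U i x * A x y * V y j) = id_fun_mat i j"
  shows "rank_ge Xs Y A r"
proof -
  obtain h where h: "bij_betw h {..<card R} R"
    using ex_bij_betw_nat_finite[OF assms(1)] by (auto simp: atLeast0LessThan)
  have hR: "h i \<in> R" if "i < r" for i using h that assms(2) by (force simp: bij_betw_def)
  have hi: "h i = h j \<longleftrightarrow> i = j" if "i < r" "j < r" for i j
    using h that assms(2) by (auto simp: bij_betw_def dest!: inj_onD)
  show ?thesis unfolding rank_ge_def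
    by (intro exI[of _ "\<lambda>i. U (h i)"] exI[of _ "\<lambda>y j. V y (h j)"])
       (auto simp: * hR hi id_fun_mat_def)
qed

text \<open>Induction on the rows: either the new row is reproduced by the generalized inverse built
  so far, or the residual row and a column where it does not vanish border the identity block.\<close>

lemma rank_normal_form:
  assumes "finite Xs" "finite Y"
  shows "\<exists>(r::nat) U V. (\<forall>i<r. \<forall>j<r. (\<Sum>x\<in>Xs. \<Sum>y\<in>Y. U i x * A x y * V y j) = id_fun_mat i j) \<and>
     (\<forall>x\<in>Xs. \<forall>y\<in>Y. A x y = (\<Sum>i<r. (\<Sum>z\<in>Y. A x z * V z i) * (\<Sum>w\<in>Xs. U i w * A w y)))"
  using assms(1)
proof (induction Xs rule: finite_induct)
  case empty
  show ?case by (rule exI[of _ 0]) simp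
next
  case (insert a Xs)
  obtain r :: nat and U V where UV0: "\<forall>i<r. \<forall>j<r. (\<Sum>x\<in>Xs. \<Sum>y\<in>Y. U i x * A x y * V y j) = id_fun_mat i j"
    and fac0: "\<forall>x\<in>Xs. \<forall>y\<in>Y. A x y = (\<Sum>i<r. (\<Sum>z\<in>Y. A x z * V z i) * (\<Sum>w\<in>Xs. U i w * A w y))"
    using insert.IH by (elim exE conjE)
  note UV = UV0[rule_format] and fac = fac0[rule_format]
  define UA where "UA i y = (\<Sum>w\<in>Xs. U i w * A w y)" for i y
  define AV where "AV x j = (\<Sum>z\<in>Y. A x z * V z j)" for x j
  have UAV: "(\<Sum>y\<in>Y. UA i y * V y j) = id_fun_mat i j" if "i < r" "j < r" for i j
    using UV[OF that] unfolding UA_def sum_distrib_right by (subst sum.swap)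
  have fac': "A x y = (\<Sum>i<r. AV x i * UA i y)" if "x \<in> Xs" "y \<in> Y" for x y
    using fac[OF that] by (simp add: AV_def UA_def)
  \<comment> \<open>The part of the new row that the old generalized inverse does not reproduce; it
    is orthogonal to all old columns of \<open>V\<close>.\<close>
  define \<rho> where "\<rho> y = A a y - (\<Sum>i<r. AV a i * UA i y)" for y
  have rhoV: "(\<Sum>y\<in>Y. \<rho> y * V y j) = 0" if "j < r" for j
  proof -
    have "(\<Sum>y\<in>Y. \<rho> y * V y j) = AV a j - (\<Sum>y\<in>Y. \<Sum>i<r. AV a i * (UA i y * V y j))"
      by (simp add: \<rho>_def AV_def left_diff_distrib sum_subtractf sum_distrib_right mult.assoc)
    also have "(\<Sum>y\<in>Y. \<Sum>i<r. AV a i * (UA i y * V y j)) = (\<Sum>i<r. AV a i * id_fun_mat i j)"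
      by (subst sum.swap) (simp add: sum_distrib_left[symmetric] UAV that)
    also have "\<dots> = AV a j" using that by simp
    finally show ?thesis by simp
  qed
  show ?case
  proof (cases "\<forall>y\<in>Y. \<rho> y = 0")
    case True
    define U' where "U' i x = (if x = a then 0 else U i x)" for i x
    have U'A: "(\<Sum>w\<in>insert a Xs. U' i w * A w y) = UA i y" for i y
      using insert.hyps by (auto simp: U'_def UA_def intro!: sum.cong)
    have U'AV: "(\<Sum>x\<in>insert a Xs. \<Sum>y\<in>Y. U' i x * A x y * V y j) = (\<Sum>y\<in>Y. UA i y * V y j)" for i j
      unfolding U'A[symmetric] sum_distrib_right by (rule sum.swap)
    show ?thesis
      by (intro exI[of _ r] exI[of _ U'] exI[of _ V])
         (use True fac' in \<open>auto simp: U'AV U'A UAV AV_def[symmetric] \<rho>_def simp del: sum.insert\<close>)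
  next
    case False
    then obtain b where b: "b \<in> Y" "\<rho> b \<noteq> 0" by blast
    \<comment> \<open>The last row of \<open>U'\<close> extracts the residual row divided by
      \<open>\<rho> b\<close>. The last column of \<open>V'\<close> is the unit vector at
      \<open>b\<close> minus its part seen by the old rows, so the enlarged compression is again the
      identity, with corner entry \<open>\<rho> b / \<rho> b\<close>.\<close>
    define U' where "U' i x =
      (if i < r then (if x = a then 0 else U i x)
       else (if x = a then 1 else - (\<Sum>k<r. AV a k * U k x)) / \<rho> b)" for i x
    define V' where "V' y j =
      (if j < r then V y j else id_fun_mat y b - (\<Sum>k<r. V y k * UA k b))" for y j
    have U'A: "(\<Sum>w\<in>insert a Xs. U' i w * A w y) = (if i < r then UA i y else \<rho> y / \<rho> b)" for i y
    proof (cases "i < r")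
      case True
      then show ?thesis using insert.hyps by (auto simp: U'_def UA_def intro!: sum.cong)
    next
      case False
      have "(\<Sum>w\<in>insert a Xs. U' i w * A w y) = U' i a * A a y + (\<Sum>w\<in>Xs. U' i w * A w y)"
        using insert.hyps by simp
      also have "(\<Sum>w\<in>Xs. U' i w * A w y) = (\<Sum>w\<in>Xs. - (\<Sum>k<r. AV a k * U k w) * A w y / \<rho> b)"
        using insert.hyps False by (intro sum.cong) (auto simp: U'_def)
      also have "\<dots> = - (\<Sum>w\<in>Xs. \<Sum>k<r. AV a k * (U k w * A w y)) / \<rho> b"
        by (simp add: sum_divide_distrib[symmetric] sum_negf sum_distrib_right mult.assoc)
      also have "(\<Sum>w\<in>Xs. \<Sum>k<r. AV a k * (U k w * A w y)) = (\<Sum>k<r. AV a k * UA k y)"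
        by (subst sum.swap) (simp add: UA_def sum_distrib_left)
      finally show ?thesis using False by (simp add: U'_def \<rho>_def diff_divide_distrib)
    qed
    have row: "(\<Sum>z\<in>Y. f z * V' z j) = (if j < r then (\<Sum>z\<in>Y. f z * V z j)
        else f b - (\<Sum>k<r. (\<Sum>z\<in>Y. f z * V z k) * UA k b))" for f j
    proof (cases "j < r")
      case False
      have "(\<Sum>z\<in>Y. f z * V' z j) = f b - (\<Sum>z\<in>Y. \<Sum>k<r. f z * V z k * UA k b)"
        using False b(1) assms(2)
        by (simp add: V'_def right_diff_distrib sum_subtractf sum_distrib_left mult.assoc)
      then show ?thesis using False by (subst (asm) sum.swap) (simp add: sum_distrib_right)
    qed (simp add: V'_def)
    have U'AV': "(\<Sum>x\<in>insert a Xs. \<Sum>y\<in>Y. U' i x * A x y * V' y j) = id_fun_mat i j"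
      if ij: "i < Suc r" "j < Suc r" for i j
    proof -
      have "(\<Sum>x\<in>insert a Xs. \<Sum>y\<in>Y. U' i x * A x y * V' y j)
          = (\<Sum>y\<in>Y. (\<Sum>w\<in>insert a Xs. U' i w * A w y) * V' y j)"
        unfolding sum_distrib_right by (rule sum.swap)
      also have "\<dots> = id_fun_mat i j"
      proof (cases "i < r")
        case True
        then have "(\<Sum>y\<in>Y. (\<Sum>w\<in>insert a Xs. U' i w * A w y) * V' y j)
            = (if j < r then id_fun_mat i j else 0)"
          unfolding U'A by (simp add: row UAV)
        then show ?thesis using True ij by (auto simp: id_fun_mat_def)
      next
        case False
        then have "(\<Sum>y\<in>Y. (\<Sum>w\<in>insert a Xs. U' i w * A w y) * V' y j) = (\<Sum>y\<in>Y. \<rho> y * V' y j) / \<rho> b"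
          unfolding U'A by (simp add: sum_divide_distrib)
        then show ?thesis using False ij b(2) by (auto simp: row rhoV id_fun_mat_def)
      qed
      finally show ?thesis .
    qed
    have AV': "(\<Sum>z\<in>Y. A x z * V' z i) = (if i < r then AV x i else if x = a then \<rho> b else 0)"
      if "x \<in> insert a Xs" for x i
      using that fac'[of x b] b(1) by (auto simp: row AV_def[symmetric] \<rho>_def)
    show ?thesis
    proof (intro exI[of _ "Suc r"] exI[of _ U'] exI[of _ V'] conjI allI impI ballI)
      fix x y assume xy: "x \<in> insert a Xs" "y \<in> Y"
      show "A x y = (\<Sum>i<Suc r. (\<Sum>z\<in>Y. A x z * V' z i) * (\<Sum>w\<in>insert a Xs. U' i w * A w y))"
        using xy fac'[of x y] b(2) insert.hyps
        by (auto simp: U'A AV'[OF xy(1)] \<rho>_def simp del: sum.insert)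
    qed (rule U'AV')
  qed
qed

lemma exact_rank:
  assumes "finite Xs" "finite Y"
  obtains r where "rank_ge Xs Y A r" "rank_le Xs Y A r"
proof -
  obtain r :: nat and U V where
    "\<forall>i<r. \<forall>j<r. (\<Sum>x\<in>Xs. \<Sum>y\<in>Y. U i x * A x y * V y j) = id_fun_mat i j"
    "\<forall>x\<in>Xs. \<forall>y\<in>Y. A x y = (\<Sum>i<r. (\<Sum>z\<in>Y. A x z * V z i) * (\<Sum>w\<in>Xs. U i w * A w y))"
    using rank_normal_form[OF assms, of A] by (elim exE conjE)
  then have "rank_ge Xs Y A r" "rank_le Xs Y A r"
    unfolding rank_ge_def rank_le_def by (fast intro: exI)+
  then show thesis by (rule that)
qed

text \<open>The best lower certificate matches the smallest factorization, so a lower bound may be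
  proved by bounding the size of every factorization, as in
  \<open>tensor_minus_id_rank_ge\<close>.\<close>

lemma rank_geI:
  assumes "finite Xs" "finite Y" "\<And>s. rank_le Xs Y A s \<Longrightarrow> r \<le> s"
  shows "rank_ge Xs Y A r"
proof -
  obtain s where s: "rank_ge Xs Y A s" "rank_le Xs Y A s" using exact_rank assms(1,2) by blast
  then have "r \<le> s" using assms(3) by blast
  then show ?thesis using s(1) unfolding rank_ge_def by (meson less_le_trans)
qed


section \<open>Agreement with the rank of complex matrices\<close>

lemma vec_space_rank_le:
  fixes M :: "complex mat"
  assumes "M \<in> carrier_mat n m" "rank_le {..<n} {..<m} (\<lambda>i j. M $$ (i, j)) r"
  shows "vec_space.rank n M \<le> r"
proof -
  interpret vec_space "TYPE(complex)" n .
  obtain B C where BC: "\<forall>i\<in>{..<n}. \<forall>j\<in>{..<m}. M $$ (i, j) = (\<Sum>k<r. B i k * C k j)"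
    using assms(2) unfolding rank_le_def by (elim exE)
  \<comment> \<open>A factorization of size \<open>s\<close> is a sum of \<open>s\<close> matrices
    of rank at most 1, and rank is subadditive.\<close>
  have "rank (mat n m (\<lambda>(i, j). \<Sum>k<s. B i k * C k j)) \<le> s" for s
  proof (induction s)
    case 0
    have "mat n m (\<lambda>(i, j). \<Sum>k<0. B i k * C k j) = 0\<^sub>m n m" by auto
    then show ?case by (simp only: rank_0I)
  next
    case (Suc s)
    have "rank (mat n m (\<lambda>(i, j). B i s * C s j)) \<le> 1"
      by (rule rank_le_1_product_entries[of _ m "\<lambda>i. B i s" "\<lambda>j. C s j"]) auto
    moreover have "mat n m (\<lambda>(i, j). \<Sum>k<Suc s. B i k * C k j)
       = mat n m (\<lambda>(i, j). \<Sum>k<s. B i k * C k j) + mat n m (\<lambda>(i, j). B i s * C s j)"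
      by (rule eq_matI) auto
    ultimately show ?case
      using Suc rank_subadditive[of "mat n m (\<lambda>(i, j). \<Sum>k<s. B i k * C k j)" m
          "mat n m (\<lambda>(i, j). B i s * C s j)"] by simp
  qed
  moreover have "M = mat n m (\<lambda>(i, j). \<Sum>k<r. B i k * C k j)"
    using assms(1) BC by (intro eq_matI) auto
  ultimately show ?thesis by simp
qed

lemma rank_le_vec_space_rank:
  fixes M :: "complex mat"
  assumes M: "M \<in> carrier_mat n m"
  shows "rank_le {..<n} {..<m} (\<lambda>i j. M $$ (i, j)) (vec_space.rank n M)"
proof -
  interpret vec_space "TYPE(complex)" n .
  \<comment> \<open>A maximal independent set of columns spans all columns: its vectors form the
    left factor, the coefficients of the columns the right one.\<close>
  obtain S where S: "finite S" "maximal S (\<lambda>T. T \<subseteq> set (cols M) \<and> lin_indpt T)"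
    using maximal_exists_superset[of "set (cols M)" "\<lambda>T. T \<subseteq> set (cols M) \<and> lin_indpt T" "{}"]
    by (auto simp: lin_dep_def)
  have colsM: "set (cols M) \<subseteq> carrier_vec n" using cols_dim M by blast
  have Sc: "S \<subseteq> set (cols M)" "lin_indpt S" using S(2) by (auto simp: maximal_def)
  then have Sn: "S \<subseteq> carrier_vec n" using colsM by blast
  have span: "v \<in> span S" if v: "v \<in> set (cols M)" for v
  proof (rule ccontr)
    assume "v \<notin> span S"
    moreover have "v \<in> carrier_vec n" using v colsM by blast
    ultimately have "lin_indpt (S \<union> {v})" "v \<notin> S"
      using lin_dep_iff_in_span[OF Sn Sc(2)] span_mem[OF Sn] by auto
    moreover have "S \<union> {v} = S"
      using S(2) v Sc(1) \<open>lin_indpt (S \<union> {v})\<close> unfolding maximal_def by blast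
    ultimately show False by blast
  qed
  have "\<exists>a. col M j = lincomb a S" if "j < m" for j
  proof -
    have "col M j \<in> span S" using that M by (intro span) (auto simp: cols_def)
    then obtain a where "lincomb a S = col M j" using finite_in_span[OF S(1)] Sn by auto
    then show ?thesis by (intro exI) (rule sym)
  qed
  then obtain a where a: "\<And>j. j < m \<Longrightarrow> col M j = lincomb (a j) S" by metis
  have "rank M = card S" by (rule rank_card_indpt[OF M S(2)])
  then show ?thesis
  proof (intro rank_le_index_set[OF S(1), of _ _ _ _ "\<lambda>i x. x $ i" "\<lambda>x j. a j x"])
    fix i j assume ij: "i \<in> {..<n}" "j \<in> {..<m}"
    then have "M $$ (i, j) = lincomb (a j) S $ i" using M a[of j] by (metis carrier_matD index_col lessThan_iff)
    also have "\<dots> = (\<Sum>x\<in>S. x $ i * a j x)"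
      using ij lincomb_index[of i S "a j"] Sn by (simp add: mult.commute)
    finally show "M $$ (i, j) = (\<Sum>x\<in>S. x $ i * a j x)" .
  qed auto
qed

section \<open>Block matrices\<close>

lemma sum_over_Times: "(\<Sum>p\<in>A \<times> B. f p) = (\<Sum>a\<in>A. \<Sum>b\<in>B. f (a, b))"
  by (simp add: sum.cartesian_product)

text \<open>The bound may vary with the block: later most column blocks have a small defect and the
  few exceptional ones are charged their full width.\<close>

lemma rank_le_col_blocks:
  assumes "finite S" "\<And>t. t \<in> S \<Longrightarrow> rank_le Xs Z (\<lambda>x z. A x (t, z)) (r t)"
  shows "rank_le Xs (S \<times> Z) A (\<Sum>t\<in>S. r t)"
proof -
  have "rank_le Xs (S \<times> Z) (\<lambda>x p. if fst p = t then A x p else 0) (r t)" if t: "t \<in> S" for t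
  proof -
    obtain B C where BC: "\<forall>x\<in>Xs. \<forall>z\<in>Z. A x (t, z) = (\<Sum>i<r t. B x i * C i z)"
      using assms(2)[OF t] unfolding rank_le_def by (elim exE)
    show ?thesis
      by (rule rank_le_index_set[of "{..<r t}" _ _ _ _ B "\<lambda>i p. if fst p = t then C i (snd p) else 0"])
         (use BC in auto)
  qed
  then have "rank_le Xs (S \<times> Z) (\<lambda>x p. \<Sum>t\<in>S. if fst p = t then A x p else 0) (\<Sum>t\<in>S. r t)"
    using assms(1) by (intro rank_le_sum)
  then show ?thesis by (rule rank_le_cong) (use assms(1) in auto)
qed

text \<open>The certificate looks only at rows over \<sigma> t and columns over t' with t and t' in
  \<open>T\<close>. There the matrix is block diagonal up to the relabelling \<sigma>, and the
  certificates of the blocks are put side by side.\<close>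

lemma rank_ge_blocks:
  assumes fin: "finite S" "finite Z" and T: "T \<subseteq> S" "\<sigma> ` T \<subseteq> S" "inj_on \<sigma> T"
    and M: "\<And>t. t \<in> T \<Longrightarrow> rank_ge Z Z (M t) r"
    and A: "\<And>t t' z z'. t \<in> T \<Longrightarrow> t' \<in> T \<Longrightarrow> z \<in> Z \<Longrightarrow> z' \<in> Z \<Longrightarrow>
       A (\<sigma> t, z) (t', z') = (if t = t' then M t z z' else 0)"
  shows "rank_ge (S \<times> Z) (S \<times> Z) A (card T * r)"
proof -
  have "\<forall>t. \<exists>U V. t \<in> T \<longrightarrow> (\<forall>i<r. \<forall>j<r. (\<Sum>x\<in>Z. \<Sum>y\<in>Z. U i x * M t x y * V y j) = id_fun_mat i j)"
    using M unfolding rank_ge_def by simp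
  then obtain U V where UV0: "\<forall>t. t \<in> T \<longrightarrow> (\<forall>i<r. \<forall>j<r.
      (\<Sum>x\<in>Z. \<Sum>y\<in>Z. U t i x * M t x y * V t y j) = id_fun_mat i j)"
    unfolding choice_iff by (elim exE)
  note UV = UV0[rule_format]
  define U' where "U' = (\<lambda>(t, i) (s, z). if s = \<sigma> t then U t i z else 0)"
  define V' where "V' = (\<lambda>(s, z) (t, j). if s = t then V t z j else 0)"
  show ?thesis
  proof (rule rank_ge_index_set[where R = "T \<times> {..<r}" and U = U' and V = V'])
    fix p q assume "p \<in> T \<times> {..<r}" "q \<in> T \<times> {..<r}"
    then obtain t i t' j where pq: "p = (t, i)" "q = (t', j)" "t \<in> T" "t' \<in> T" "i < r" "j < r" by auto
    have *: "(\<Sum>y\<in>S \<times> Z. f y * V' y q) = (\<Sum>z\<in>Z. f (t', z) * V t' z j)" for f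
    proof -
      have "(\<Sum>y\<in>S \<times> Z. f y * V' y q) = (\<Sum>s\<in>S. \<Sum>z\<in>Z. f (s, z) * V' (s, z) q)"
        by (simp add: sum.cartesian_product)
      also have "\<dots> = (\<Sum>s\<in>S. if s = t' then \<Sum>z\<in>Z. f (t', z) * V t' z j else 0)"
        by (intro sum.cong) (auto simp: V'_def pq)
      finally show ?thesis using fin pq T by (simp add: subset_iff)
    qed
    have "(\<Sum>x\<in>S \<times> Z. \<Sum>y\<in>S \<times> Z. U' p x * A x y * V' y q)
        = (\<Sum>x\<in>S \<times> Z. \<Sum>z'\<in>Z. U' p x * A x (t', z') * V t' z' j)"
      by (simp add: *)
    also have "\<dots> = (\<Sum>s\<in>S. \<Sum>z\<in>Z. \<Sum>z'\<in>Z. U' p (s, z) * A (s, z) (t', z') * V t' z' j)"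
      by (rule sum_over_Times)
    also have "\<dots> = (\<Sum>s\<in>S. if s = \<sigma> t
        then \<Sum>z\<in>Z. \<Sum>z'\<in>Z. U t i z * A (\<sigma> t, z) (t', z') * V t' z' j else 0)"
      by (intro sum.cong) (auto simp: U'_def pq)
    also have "\<dots> = (\<Sum>z\<in>Z. \<Sum>z'\<in>Z. U t i z * A (\<sigma> t, z) (t', z') * V t' z' j)"
      using fin pq T by (auto simp: subset_iff)
    also have "\<dots> = (\<Sum>z\<in>Z. \<Sum>z'\<in>Z. U t i z * (if t = t' then M t z z' else 0) * V t' z' j)"
      using pq by (intro sum.cong refl) (simp add: A)
    also have "\<dots> = id_fun_mat p q"
      by (cases "t = t'") (use pq UV[of t i j] in \<open>simp_all add: id_fun_mat_def\<close>)
    finally show "(\<Sum>x\<in>S \<times> Z. \<Sum>y\<in>S \<times> Z. U' p x * A x y * V' y q) = id_fun_mat p q" .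
  qed (use fin T in \<open>auto simp: card_cartesian_product finite_subset\<close>)
qed

section \<open>Tensor products\<close>

definition tensor :: "'u set \<Rightarrow> ('u \<Rightarrow> 'z \<Rightarrow> 'z \<Rightarrow> complex) \<Rightarrow> ('u \<Rightarrow> 'z) \<Rightarrow> ('u \<Rightarrow> 'z) \<Rightarrow> complex" where
  "tensor S D = (\<lambda>x y. \<Prod>u\<in>S. D u (x u) (y u))"

text \<open>Extensional functions, so that tuples are equal as soon as they agree on
  \<open>S\<close>, and for finite sets their number is \<open>card Z ^ card S\<close>.\<close>

abbreviation tuples :: "'u set \<Rightarrow> 'z set \<Rightarrow> ('u \<Rightarrow> 'z) set" where
  "tuples S Z \<equiv> PiE S (\<lambda>_. Z)"

text \<open>The mixed product rule: distributing a product over sums chooses a summation index for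
  every \<open>u\<close>, which is a tuple.\<close>

lemma tensor_matmul:
  assumes "finite S" "finite Z"
  shows "matmul (tuples S Z) (tensor S D) (tensor S E) = tensor S (\<lambda>u. matmul Z (D u) (E u))"
proof (intro ext)
  fix x y
  show "matmul (tuples S Z) (tensor S D) (tensor S E) x y = tensor S (\<lambda>u. matmul Z (D u) (E u)) x y"
    unfolding matmul_def tensor_def prod.distrib[symmetric]
    using assms by (subst prod_sum_PiE) auto
qed

lemma tensor_id:
  assumes "finite S" "x \<in> tuples S Z" "y \<in> tuples S Z"
  shows "tensor S (\<lambda>_. id_fun_mat) x y = id_fun_mat x y"
proof (cases "x = y")
  case False
  then obtain u where "u \<in> S" "x u \<noteq> y u" using assms PiE_ext by metis
  then show ?thesis using assms False by (auto simp: tensor_def id_fun_mat_def intro!: prod_zero)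
qed (simp add: tensor_def id_fun_mat_def)

lemma tensor_cong:
  assumes "\<And>u i j. u \<in> S \<Longrightarrow> i \<in> Z \<Longrightarrow> j \<in> Z \<Longrightarrow> D u i j = E u i j"
    and "x \<in> tuples S Z" "y \<in> tuples S Z"
  shows "tensor S D x y = tensor S E x y"
  unfolding tensor_def
  by (intro prod.cong refl assms(1)) (use assms(2,3) in \<open>auto dest: PiE_mem\<close>)

text \<open>The factor at \<open>v\<close> goes through \<open>r\<close> dimensions, the others
  through their whole space of dimension \<open>card Z ^ (card S - 1)\<close>. Relative to the total
  dimension the bound is that of \<open>D v\<close>.\<close>

lemma tensor_rank_le:
  assumes fin: "finite S" "finite Z" and v: "v \<in> S" and r: "rank_le Z Z (D v) r"
  shows "rank_le (tuples S Z) (tuples S Z) (tensor S D) (r * card Z ^ (card S - 1))"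
proof -
  obtain B C where BC: "\<forall>i\<in>Z. \<forall>j\<in>Z. D v i j = (\<Sum>k<r. B i k * C k j)"
    using r unfolding rank_le_def by (elim exE)
  let ?S = "S - {v}"
  let ?B = "\<lambda>x (k, w). B (x v) k * tensor ?S D x w"
  let ?C = "\<lambda>(k, w) y. C k (y v) * id_fun_mat w (restrict y ?S)"
  show ?thesis
  proof (rule rank_le_index_set[of "{..<r} \<times> tuples ?S Z" _ _ _ _ ?B ?C])
    show "card ({..<r} \<times> tuples ?S Z) \<le> r * card Z ^ (card S - 1)"
      using fin v by (simp add: card_cartesian_product card_PiE)
  next
    fix x y assume xy: "x \<in> tuples S Z" "y \<in> tuples S Z"
    have "(\<Sum>p\<in>{..<r} \<times> tuples ?S Z. ?B x p * ?C p y)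
        = (\<Sum>k<r. \<Sum>w\<in>tuples ?S Z. (B (x v) k * tensor ?S D x w * C k (y v)) * id_fun_mat w (restrict y ?S))"
      by (simp add: sum.cartesian_product case_prod_unfold mult.assoc)
    also have "\<dots> = (\<Sum>k<r. B (x v) k * tensor ?S D x (restrict y ?S) * C k (y v))"
      using xy fin by (intro sum.cong refl) (subst id_fun_mat_sum, auto simp: finite_PiE)
    also have "tensor ?S D x (restrict y ?S) = tensor ?S D x y"
      unfolding tensor_def by (rule prod.cong) auto
    also have "(\<Sum>k<r. B (x v) k * tensor ?S D x y * C k (y v)) = D v (x v) (y v) * tensor ?S D x y"
    proof -
      have "D v (x v) (y v) = (\<Sum>k<r. B (x v) k * C k (y v))"
        using xy v BC by (auto dest: PiE_mem)
      then show ?thesis by (simp add: sum_distrib_left sum_distrib_right mult_ac)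
    qed
    also have "\<dots> = tensor S D x y"
      unfolding tensor_def using fin v by (simp add: prod.remove[of S v])
    finally show "tensor S D x y = (\<Sum>p\<in>{..<r} \<times> tuples ?S Z. ?B x p * ?C p y)" by (rule sym)
  qed (use fin in \<open>auto simp: finite_PiE\<close>)
qed

text \<open>Telescoping: the factors are exchanged one after the other, and each exchange changes
  the tensor product by one whose factor at the exchanged place is a difference
  \<open>D v - E v\<close>.\<close>

lemma tensor_diff_rank_le:
  assumes fin: "finite S" "finite Z"
    and r: "\<And>u. u \<in> S \<Longrightarrow> rank_le Z Z (\<lambda>i j. D u i j - E u i j) r"
  shows "rank_le (tuples S Z) (tuples S Z) (\<lambda>x y. tensor S D x y - tensor S E x y)
     (card S * (r * card Z ^ (card S - 1)))"
proof -
  define F where "F U u = (if u \<in> U then D u else E u)" for U u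
  have "rank_le (tuples S Z) (tuples S Z) (\<lambda>x y. tensor S (F U) x y - tensor S E x y)
     (card U * (r * card Z ^ (card S - 1)))" if "finite U" "U \<subseteq> S" for U
    using that
  proof (induction U rule: finite_induct)
    case empty
    have "F {} = E" by (auto simp: F_def)
    then show ?case by (simp add: rank_le_def)
  next
    case (insert v U)
    \<comment> \<open>By linearity in the factor at \<open>v\<close>, the change from
      \<open>F U\<close> to \<open>F (insert v U)\<close> is the tensor product of
      \<open>K\<close>.\<close>
    define K where "K u = (if u = v then (\<lambda>i j. D v i j - E v i j) else F U u)" for u
    have split: "tensor S L x y = L v (x v) (y v) * tensor (S - {v}) L x y" for L x y
      unfolding tensor_def using fin insert.prems by (simp add: prod.remove[of S v])
    have rest: "tensor (S - {v}) (F (insert v U)) = tensor (S - {v}) (F U)"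
      "tensor (S - {v}) K = tensor (S - {v}) (F U)"
      unfolding tensor_def by (intro ext prod.cong; simp add: F_def K_def)+
    have "tensor S (F (insert v U)) x y - tensor S E x y
        = tensor S K x y + (tensor S (F U) x y - tensor S E x y)" for x y
      unfolding split[of "F (insert v U)"] split[of K] split[of "F U"] rest
      using insert.hyps by (simp add: F_def K_def algebra_simps)
    moreover have "rank_le (tuples S Z) (tuples S Z) (tensor S K) (r * card Z ^ (card S - 1))"
      by (rule tensor_rank_le[of _ _ v]) (use fin insert.prems r in \<open>auto simp: K_def\<close>)
    moreover have "card (insert v U) * (r * card Z ^ (card S - 1))
        = r * card Z ^ (card S - 1) + card U * (r * card Z ^ (card S - 1))"
      using insert.hyps by simp
    ultimately show ?case
      using insert.IH insert.prems by (simp only:) (intro rank_le_add; simp)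
  qed
  from this[of S] fin show ?thesis by (simp add: F_def tensor_def)
qed

section \<open>Tensor products of matrices with a trivial summand\<close>

definition one_oplus :: "('i \<Rightarrow> 'i \<Rightarrow> complex) \<Rightarrow> bool \<times> 'i \<Rightarrow> bool \<times> 'i \<Rightarrow> complex" where
  "one_oplus P = (\<lambda>(b, i) (c, j). if b \<noteq> c then 0 else if b then P i j else id_fun_mat i j)"

lemma one_oplus_matmul:
  assumes "finite N" "p \<in> UNIV \<times> N" "q \<in> UNIV \<times> N"
  shows "matmul (UNIV \<times> N) (one_oplus P) (one_oplus Q) p q = one_oplus (matmul N P Q) p q"
  using assms
  by (cases p; cases q) (auto simp: matmul_def one_oplus_def sum_over_Times UNIV_bool)

lemma one_oplus_id: "one_oplus id_fun_mat = id_fun_mat"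
  by (auto simp: one_oplus_def id_fun_mat_def fun_eq_iff)

text \<open>The identity summands cancel, so the absolute defect stays the same while the dimension
  doubles.\<close>

lemma one_oplus_diff_rank_le:
  assumes "rank_le N N (\<lambda>i j. P i j - Q i j) r"
  shows "rank_le (UNIV \<times> N) (UNIV \<times> N) (\<lambda>p q. one_oplus P p q - one_oplus Q p q) r"
proof -
  obtain B C where BC: "\<forall>i\<in>N. \<forall>j\<in>N. P i j - Q i j = (\<Sum>k<r. B i k * C k j)"
    using assms unfolding rank_le_def by (elim exE)
  show ?thesis
    by (rule rank_le_index_set[of "{..<r}" _ _ _ _ "\<lambda>p k. if fst p then B (snd p) k else 0"
          "\<lambda>k p. if fst p then C k (snd p) else 0"])
       (use BC in \<open>auto simp: one_oplus_def\<close>)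
qed

text \<open>With \<open>D v = 1 \<oplus> P\<close> and \<open>Q\<close> the tensor product of the other factors, \<open>tensor S D - 1\<close> is the block
  diagonal matrix with blocks \<open>1 \<otimes> Q - 1\<close> and \<open>P \<otimes> Q - 1\<close>, whose difference \<open>(P - 1) \<otimes> Q\<close> has the
  rank of \<open>(P - 1) \<otimes> 1\<close> because \<open>Q\<close> is invertible.\<close>

lemma tensor_minus_id_rank_ge:
  assumes fin: "finite S" "finite N" and v: "v \<in> S"
    and Dv: "D v = one_oplus P" and P: "rank_ge N N (\<lambda>i j. P i j - id_fun_mat i j) r"
    and L: "\<And>u p q. u \<in> S \<Longrightarrow> p \<in> UNIV \<times> N \<Longrightarrow> q \<in> UNIV \<times> N \<Longrightarrow>
       matmul (UNIV \<times> N) (L u) (D u) p q = id_fun_mat p q"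
  shows "rank_ge (tuples S (UNIV \<times> N)) (tuples S (UNIV \<times> N))
     (\<lambda>x y. tensor S D x y - id_fun_mat x y) (card (UNIV \<times> N :: (bool \<times> _) set) ^ (card S - 1) * r)"
proof (rule rank_geI)
  let ?Z = "UNIV \<times> N :: (bool \<times> _) set"
  let ?S = "S - {v}"
  let ?W = "tuples ?S ?Z"
  show "finite (tuples S ?Z)" "finite (tuples S ?Z)" using fin by (auto simp: finite_PiE)
  have finW: "finite ?W" using fin by (auto simp: finite_PiE)
  fix s assume "rank_le (tuples S ?Z) (tuples S ?Z) (\<lambda>x y. tensor S D x y - id_fun_mat x y) s"
  then obtain B C where BC: "\<forall>x\<in>tuples S ?Z. \<forall>y\<in>tuples S ?Z.
      tensor S D x y - id_fun_mat x y = (\<Sum>k<s. B x k * C k y)"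
    unfolding rank_le_def by (elim exE)
  \<comment> \<open>\<open>e False\<close> and \<open>e True\<close> embed the two halves of the
    space at \<open>v\<close> and so single out the blocks \<open>1 \<otimes> Q\<close> and
    \<open>P \<otimes> Q\<close>.\<close>
  define e where "e b p = (fst p)(v := (b, snd p))" for b :: bool and p :: "('a \<Rightarrow> bool \<times> 'b) \<times> 'b"
  have eW: "e b p \<in> tuples S ?Z" if "p \<in> ?W \<times> N" for b p
    using that v by (auto simp: e_def PiE_def Pi_def extensional_def)
  have ten: "tensor S D (e b p) (e c q) = one_oplus P (b, snd p) (c, snd q) * tensor ?S D (fst p) (fst q)"
    for b c p q
  proof -
    have "tensor S D (e b p) (e c q) = D v (e b p v) (e c q v) * tensor ?S D (e b p) (e c q)"
      unfolding tensor_def using fin v by (simp add: prod.remove[of S v])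
    also have "tensor ?S D (e b p) (e c q) = tensor ?S D (fst p) (fst q)"
      unfolding tensor_def by (rule prod.cong) (auto simp: e_def)
    moreover have "e b p v = (b, snd p)" "e c q v = (c, snd q)" by (simp_all add: e_def)
    ultimately show ?thesis by (simp add: Dv)
  qed
  have ide: "id_fun_mat (e b p) (e c q) = (if b = c then id_fun_mat p q else 0)"
    if "p \<in> ?W \<times> N" "q \<in> ?W \<times> N" for b c p q
  proof -
    have "fst p = fst q" if "e b p = e c q"
    proof
      fix u
      show "fst p u = fst q u"
      proof (cases "u = v")
        case True
        then show ?thesis using \<open>p \<in> _\<close> \<open>q \<in> _\<close> by (auto simp: PiE_def extensional_def)
      next
        case False
        then show ?thesis using fun_cong[OF that, of u] by (simp add: e_def)
      qed
    qed
    moreover have "b = c \<and> snd p = snd q" if "e b p = e c q"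
      using fun_cong[OF that, of v] by (simp add: e_def)
    ultimately have "e b p = e c q \<longleftrightarrow> b = c \<and> p = q" by (auto intro: prod_eqI)
    then show ?thesis by (simp add: id_fun_mat_def)
  qed
  \<comment> \<open>Adding the two block rows and subtracting the two block columns in a single
    compression yields the difference of the diagonal blocks, since the off-diagonal ones vanish.
    Hence the bound stays \<open>s\<close> rather than \<open>2 * s\<close>.\<close>
  have "rank_le (?W \<times> N) (?W \<times> N) (\<lambda>p q. (P (snd p) (snd q) - id_fun_mat (snd p) (snd q)) *
      tensor ?S D (fst p) (fst q)) s"
  proof (rule rank_le_index_set[of "{..<s}" _ _ _ _ "\<lambda>p k. B (e False p) k + B (e True p) k"
        "\<lambda>k q. C k (e True q) - C k (e False q)"])
    fix p q assume pq: "p \<in> ?W \<times> N" "q \<in> ?W \<times> N"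
    have BC': "(\<Sum>k<s. B (e b p) k * C k (e c q)) = tensor S D (e b p) (e c q) - id_fun_mat (e b p) (e c q)"
      for b c using BC eW pq by simp
    have "(\<Sum>k<s. (B (e False p) k + B (e True p) k) * (C k (e True q) - C k (e False q)))
       = (\<Sum>k<s. B (e False p) k * C k (e True q)) + (\<Sum>k<s. B (e True p) k * C k (e True q))
       - (\<Sum>k<s. B (e False p) k * C k (e False q)) - (\<Sum>k<s. B (e True p) k * C k (e False q))"
      by (simp add: algebra_simps sum.distrib sum_subtractf)
    also have "\<dots> = (P (snd p) (snd q) - id_fun_mat (snd p) (snd q)) * tensor ?S D (fst p) (fst q)"
      unfolding BC' ten ide[OF pq] by (simp add: one_oplus_def algebra_simps)
    finally show "(P (snd p) (snd q) - id_fun_mat (snd p) (snd q)) * tensor ?S D (fst p) (fst q) =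
      (\<Sum>k<s. (B (e False p) k + B (e True p) k) * (C k (e True q) - C k (e False q)))" by simp
  qed auto
  \<comment> \<open>Multiplying by left inverses of the other factors removes \<open>Q\<close> and
    leaves \<open>card ?W\<close> diagonal copies of \<open>P - 1\<close>.\<close>
  then have "rank_le (?W \<times> N) (?W \<times> N)
     (matmul (?W \<times> N) (\<lambda>p q. tensor ?S L (fst p) (fst q) * id_fun_mat (snd p) (snd q))
       (\<lambda>p q. (P (snd p) (snd q) - id_fun_mat (snd p) (snd q)) * tensor ?S D (fst p) (fst q))) s"
    by (rule rank_le_matmul_left)
  then have le: "rank_le (?W \<times> N) (?W \<times> N)
     (\<lambda>p q. id_fun_mat (fst p) (fst q) * (P (snd p) (snd q) - id_fun_mat (snd p) (snd q))) s"
  proof (rule rank_le_cong)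
    fix p q assume pq: "p \<in> ?W \<times> N" "q \<in> ?W \<times> N"
    have "matmul (?W \<times> N) (\<lambda>p q. tensor ?S L (fst p) (fst q) * id_fun_mat (snd p) (snd q))
       (\<lambda>p q. (P (snd p) (snd q) - id_fun_mat (snd p) (snd q)) * tensor ?S D (fst p) (fst q)) p q
     = (\<Sum>w\<in>?W. \<Sum>i\<in>N. id_fun_mat (snd p) i * (tensor ?S L (fst p) w * tensor ?S D w (fst q) *
          (P i (snd q) - id_fun_mat i (snd q))))"
      by (simp add: matmul_def sum_over_Times mult_ac)
    also have "\<dots> = (\<Sum>w\<in>?W. tensor ?S L (fst p) w * tensor ?S D w (fst q) *
          (P (snd p) (snd q) - id_fun_mat (snd p) (snd q)))"
    proof (rule sum.cong[OF refl])
      fix w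
      have "snd p \<in> N" using pq(1) by (simp only: mem_Times_iff)
      then show "(\<Sum>i\<in>N. id_fun_mat (snd p) i * (tensor ?S L (fst p) w * tensor ?S D w (fst q) *
          (P i (snd q) - id_fun_mat i (snd q)))) = tensor ?S L (fst p) w * tensor ?S D w (fst q) *
          (P (snd p) (snd q) - id_fun_mat (snd p) (snd q))"
        by (simp only: id_fun_mat_sum(1)[OF fin(2)] if_True)
    qed
    also have "\<dots> = (\<Sum>w\<in>?W. tensor ?S L (fst p) w * tensor ?S D w (fst q)) *
          (P (snd p) (snd q) - id_fun_mat (snd p) (snd q))"
      by (simp only: sum_distrib_right)
    also have "(\<Sum>w\<in>?W. tensor ?S L (fst p) w * tensor ?S D w (fst q)) =
        matmul ?W (tensor ?S L) (tensor ?S D) (fst p) (fst q)"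
      by (simp only: matmul_def)
    also have "\<dots> = tensor ?S (\<lambda>u. matmul ?Z (L u) (D u)) (fst p) (fst q)"
      using tensor_matmul[of ?S ?Z L D] fin by simp
    also have "\<dots> = tensor ?S (\<lambda>_. id_fun_mat) (fst p) (fst q)"
    proof (rule tensor_cong)
      fix u i j assume "u \<in> ?S" "i \<in> ?Z" "j \<in> ?Z"
      then show "matmul ?Z (L u) (D u) i j = id_fun_mat i j" by (intro L) auto
    qed (use pq in \<open>simp_all add: mem_Times_iff\<close>)
    also have "\<dots> = id_fun_mat (fst p) (fst q)"
      by (rule tensor_id[where Z = ?Z]) (use fin pq in \<open>simp_all add: mem_Times_iff\<close>)
    finally show "matmul (?W \<times> N) (\<lambda>p q. tensor ?S L (fst p) (fst q) * id_fun_mat (snd p) (snd q))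
       (\<lambda>p q. (P (snd p) (snd q) - id_fun_mat (snd p) (snd q)) * tensor ?S D (fst p) (fst q)) p q =
       id_fun_mat (fst p) (fst q) * (P (snd p) (snd q) - id_fun_mat (snd p) (snd q))" .
  qed
  have "rank_ge (?W \<times> N) (?W \<times> N)
     (\<lambda>p q. id_fun_mat (fst p) (fst q) * (P (snd p) (snd q) - id_fun_mat (snd p) (snd q))) (card ?W * r)"
    by (rule rank_ge_blocks[where S = ?W and T = ?W and Z = N and r = r and
        A = "\<lambda>p q. id_fun_mat (fst p) (fst q) * (P (snd p) (snd q) - id_fun_mat (snd p) (snd q))" and \<sigma> = "\<lambda>x. x" and M = "\<lambda>_ i j. P i j - id_fun_mat i j"])
       (use finW fin P in \<open>auto simp: id_fun_mat_def\<close>)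
  from rank_ge_le_rank_le[OF this le]
  show "card ?Z ^ (card S - 1) * r \<le> s"
    using fin v by (simp add: card_PiE)
qed


text \<open>For finite square matrices a left inverse is two-sided, so this expresses membership in
  the general linear group.\<close>

definition left_invertible_on :: "'x set \<Rightarrow> ('x \<Rightarrow> 'x \<Rightarrow> complex) \<Rightarrow> bool" where
  "left_invertible_on Xs A \<longleftrightarrow> (\<exists>B. \<forall>x\<in>Xs. \<forall>y\<in>Xs. matmul Xs B A x y = id_fun_mat x y)"

lemma left_invertible_on_id: "finite Xs \<Longrightarrow> left_invertible_on Xs id_fun_mat"
  unfolding left_invertible_on_def by (rule exI[of _ id_fun_mat]) (simp add: matmul_def id_fun_mat_sum(1))

lemma rank_ge_left_invertible:
  assumes "finite Xs" "left_invertible_on Xs A"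
  shows "rank_ge Xs Xs A (card Xs)"
proof -
  obtain B where B: "\<forall>x\<in>Xs. \<forall>y\<in>Xs. matmul Xs B A x y = id_fun_mat x y"
    using assms(2) unfolding left_invertible_on_def by (elim exE)
  show ?thesis
  proof (rule rank_ge_index_set[where R = Xs and U = B and V = id_fun_mat])
    fix i j assume ij: "i \<in> Xs" "j \<in> Xs"
    have "(\<Sum>x\<in>Xs. \<Sum>y\<in>Xs. B i x * A x y * id_fun_mat y j) = (\<Sum>x\<in>Xs. B i x * A x j)"
      using assms(1) ij by (simp add: id_fun_mat_sum(2))
    then show "(\<Sum>x\<in>Xs. \<Sum>y\<in>Xs. B i x * A x y * id_fun_mat y j) = id_fun_mat i j"
      using B ij by (simp add: matmul_def)
  qed (use assms(1) in auto)
qed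

section \<open>Induction from a normal subgroup\<close>

text \<open>Since \<open>\<delta>\<close> may depend on the group element, no amplification of ranks is needed.\<close>

definition approx_rep ::
  "('a, 'b) monoid_scheme \<Rightarrow> ('a \<Rightarrow> real) \<Rightarrow> 'a set \<Rightarrow> real \<Rightarrow> 'x set \<Rightarrow> ('a \<Rightarrow> 'x \<Rightarrow> 'x \<Rightarrow> complex) \<Rightarrow> bool" where
  "approx_rep G \<delta> F \<epsilon> Xs \<phi> \<longleftrightarrow>
     (\<forall>g\<in>carrier G. left_invertible_on Xs (\<phi> g)) \<and>
     (\<forall>g\<in>F. \<forall>h\<in>F. rank_le Xs Xs (\<lambda>x y. \<phi> (g \<otimes>\<^bsub>G\<^esub> h) x y - matmul Xs (\<phi> g) (\<phi> h) x y)
        (nat \<lfloor>\<epsilon> * card Xs\<rfloor>)) \<and>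
     (\<forall>g\<in>F - {\<one>\<^bsub>G\<^esub>}. rank_ge Xs Xs (\<lambda>x y. \<phi> g x y - id_fun_mat x y) (nat \<lceil>\<delta> g * card Xs\<rceil>))"

text \<open>The bound \<open>m\<close> later makes the dimensions tend to infinity. \<delta> is
  fixed before \<open>F\<close> and \<epsilon>, so the separation it guarantees survives the
  limit.\<close>

definition rank_approximable :: "('a, 'b) monoid_scheme \<Rightarrow> ('a \<Rightarrow> real) \<Rightarrow> bool" where
  "rank_approximable G \<delta> \<longleftrightarrow> (\<forall>F \<epsilon> m. finite F \<longrightarrow> F \<subseteq> carrier G \<longrightarrow> \<epsilon> > 0 \<longrightarrow>
     (\<exists>n\<ge>m. \<exists>\<phi>. approx_rep G \<delta> F \<epsilon> {..<n::nat} \<phi>))"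

text \<open>Moves a construction from its natural index set of pairs to an initial segment of the
  naturals.\<close>

lemma approx_rep_reindex:
  assumes ap: "approx_rep G \<delta> F \<epsilon> Xs \<phi>" and h: "bij_betw h Ys Xs"
  shows "approx_rep G \<delta> F \<epsilon> Ys (\<lambda>g x y. \<phi> g (h x) (h y))"
proof -
  have hY: "h y \<in> Xs" if "y \<in> Ys" for y using h that by (auto simp: bij_betw_def)
  have mm: "matmul Ys (\<lambda>x y. A (h x) (h y)) (\<lambda>x y. B (h x) (h y)) x y = matmul Xs A B (h x) (h y)"
    for A B x y
    unfolding matmul_def using sum.reindex_bij_betw[OF h, of "\<lambda>z. A (h x) z * B z (h y)"] .
  have idm: "id_fun_mat (h x) (h y) = id_fun_mat x y" if "x \<in> Ys" "y \<in> Ys" for x y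
    using h that by (auto simp: id_fun_mat_def bij_betw_def dest: inj_onD)
  have card: "card Xs = card Ys" using h by (simp add: bij_betw_same_card)
  have inv: "left_invertible_on Ys (\<lambda>x y. A (h x) (h y))" if A: "left_invertible_on Xs A" for A
  proof -
    obtain B where B: "\<forall>x\<in>Xs. \<forall>y\<in>Xs. matmul Xs B A x y = id_fun_mat x y"
      using A unfolding left_invertible_on_def by (elim exE)
    show ?thesis unfolding left_invertible_on_def
      by (rule exI[of _ "\<lambda>x y. B (h x) (h y)"]) (simp add: mm B hY idm)
  qed
  have le: "rank_le Ys Ys (\<lambda>x y. A (h x) (h y)) r" if A: "rank_le Xs Xs A r" for A r
  proof -
    obtain B C where BC: "\<forall>x\<in>Xs. \<forall>y\<in>Xs. A x y = (\<Sum>i<r. B x i * C i y)"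
      using A unfolding rank_le_def by (elim exE)
    show ?thesis unfolding rank_le_def
      by (rule exI[of _ "\<lambda>x. B (h x)"], rule exI[of _ "\<lambda>i y. C i (h y)"]) (simp add: BC hY)
  qed
  have ge: "rank_ge Ys Ys (\<lambda>x y. A (h x) (h y) - id_fun_mat x y) r"
    if A: "rank_ge Xs Xs (\<lambda>x y. A x y - id_fun_mat x y) r" for A r
  proof -
    obtain U V where UV: "\<forall>i<r. \<forall>j<r. (\<Sum>x\<in>Xs. \<Sum>y\<in>Xs. U i x * (A x y - id_fun_mat x y) * V y j) = id_fun_mat i j"
      using A unfolding rank_ge_def by (elim exE)
    have "(\<Sum>x\<in>Ys. \<Sum>y\<in>Ys. U i (h x) * (A (h x) (h y) - id_fun_mat x y) * V (h y) j)
       = (\<Sum>x\<in>Xs. \<Sum>y\<in>Xs. U i x * (A x y - id_fun_mat x y) * V y j)" for i j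
    proof -
      have "(\<Sum>x\<in>Ys. \<Sum>y\<in>Ys. U i (h x) * (A (h x) (h y) - id_fun_mat x y) * V (h y) j)
        = (\<Sum>x\<in>Ys. \<Sum>y\<in>Ys. U i (h x) * (A (h x) (h y) - id_fun_mat (h x) (h y)) * V (h y) j)"
        by (intro sum.cong refl) (simp add: idm)
      also have "\<dots> = (\<Sum>x\<in>Ys. \<Sum>y\<in>Xs. U i (h x) * (A (h x) y - id_fun_mat (h x) y) * V y j)"
        by (intro sum.cong refl sum.reindex_bij_betw[OF h])
      also have "\<dots> = (\<Sum>x\<in>Xs. \<Sum>y\<in>Xs. U i x * (A x y - id_fun_mat x y) * V y j)"
        by (rule sum.reindex_bij_betw[OF h])
      finally show ?thesis .
    qed
    then show ?thesis unfolding rank_ge_def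
      by (intro exI[of _ "\<lambda>i x. U i (h x)"] exI[of _ "\<lambda>y. V (h y)"]) (simp add: UV)
  qed
  note ap' = ap[unfolded approx_rep_def card]
  show ?thesis unfolding approx_rep_def
    using ap' by (auto intro!: inv ge simp: mm dest: le)
qed

section \<open>Translation of cosets and the cocycle of a section\<close>

context normal begin

text \<open>By normality right cosets are left cosets, so left translation by \<open>g\<close>
  permutes them.\<close>

lemma lcos_rcos:
  assumes "g \<in> carrier G" "x \<in> carrier G"
  shows "g <#\<^bsub>G\<^esub> (H #> x) = H #> (g \<otimes> x)"
proof -
  have "g <#\<^bsub>G\<^esub> (H #> x) = g <#\<^bsub>G\<^esub> (x <#\<^bsub>G\<^esub> H)" using coset_eq assms by simp
  also have "\<dots> = (g \<otimes> x) <#\<^bsub>G\<^esub> H" using assms by (simp add: lcos_m_assoc subset)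
  also have "\<dots> = H #> (g \<otimes> x)" using coset_eq assms by simp
  finally show ?thesis .
qed

end

locale coset_section = normal H G for H and G (structure) +
  fixes S :: "'a set set"
  assumes finS: "finite S" and S: "S \<subseteq> rcosets H"
begin

definition sec :: "'a set \<Rightarrow> 'a" where "sec t = (SOME x. x \<in> t)"

text \<open>The usual cocycle of an induced representation. It lies in \<open>H\<close> when
  \<open>g\<close> carries the coset \<open>t\<close> to \<open>s\<close>; for other pairs it need
  not.\<close>

definition cocycle :: "'a \<Rightarrow> 'a set \<Rightarrow> 'a set \<Rightarrow> 'a" where
  "cocycle g s t = inv (sec s) \<otimes> g \<otimes> sec t"

lemma sec_mem: "t \<in> S \<Longrightarrow> sec t \<in> t"
  using S rcosets_non_empty unfolding sec_def by (metis ex_in_conv someI_ex subsetD)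

lemma sec_carrier: "t \<in> S \<Longrightarrow> sec t \<in> carrier G"
  using sec_mem S rcosets_carrier[OF is_group, of t] by blast

lemma sec_coset: "t \<in> S \<Longrightarrow> t = H #> sec t"
proof -
  assume t: "t \<in> S"
  then obtain a where a: "a \<in> carrier G" "t = H #> a" using S unfolding RCOSETS_def by blast
  then show "t = H #> sec t" using repr_independence[of "sec t" H a] sec_mem[OF t] subgroup_axioms by simp
qed

lemma conj_mem: "t \<in> S \<Longrightarrow> k \<in> H \<Longrightarrow> sec t \<otimes> k \<otimes> inv (sec t) \<in> H"
  using inv_op_closed2 sec_carrier by blast

lemma act_coset: "g \<in> carrier G \<Longrightarrow> t \<in> S \<Longrightarrow> g <#\<^bsub>G\<^esub> t = H #> (g \<otimes> sec t)"
  using lcos_rcos[of g "sec t"] sec_coset[of t, symmetric] sec_carrier[of t] by simp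

lemma cocycle_mem:
  assumes "g \<in> carrier G" "t \<in> S" "g <#\<^bsub>G\<^esub> t \<in> S"
  shows "cocycle g (g <#\<^bsub>G\<^esub> t) t \<in> H"
proof -
  let ?s = "sec (g <#\<^bsub>G\<^esub> t)"
  have c: "?s \<in> carrier G" "g \<otimes> sec t \<in> carrier G" using assms sec_carrier by auto
  have "?s \<in> H #> (g \<otimes> sec t)" using sec_mem[OF assms(3)] act_coset[OF assms(1,2)] by simp
  then have "?s \<in> (g \<otimes> sec t) <#\<^bsub>G\<^esub> H" using coset_eq c by simp
  then obtain h where h: "h \<in> H" "?s = (g \<otimes> sec t) \<otimes> h" by (auto simp: l_coset_def)
  have "cocycle g (g <#\<^bsub>G\<^esub> t) t = inv ?s \<otimes> (g \<otimes> sec t)"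
    using assms sec_carrier by (simp add: cocycle_def m_assoc)
  also have "\<dots> = inv h"
    using h c by (simp add: inv_mult_group m_assoc)
  finally show ?thesis using h by simp
qed

lemma cocycle_mult:
  assumes "g \<in> carrier G" "h \<in> carrier G" "r \<in> S" "s \<in> S" "t \<in> S"
  shows "cocycle (g \<otimes> h) r t = cocycle g r s \<otimes> cocycle h s t"
proof -
  have c: "sec r \<in> carrier G" "sec s \<in> carrier G" "sec t \<in> carrier G" using assms sec_carrier by auto
  have "sec s \<otimes> (inv (sec s) \<otimes> (h \<otimes> sec t)) = h \<otimes> sec t"
    using c assms by (simp add: m_assoc[symmetric])
  then show ?thesis using c assms by (simp add: cocycle_def m_assoc)
qed

lemma act_mult:
  "g \<in> carrier G \<Longrightarrow> h \<in> carrier G \<Longrightarrow> t \<in> S \<Longrightarrow> g <#\<^bsub>G\<^esub> (h <#\<^bsub>G\<^esub> t) = (g \<otimes> h) <#\<^bsub>G\<^esub> t"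
  using S rcosets_carrier[OF is_group, of t] by (intro lcos_m_assoc) auto

lemma act_inj: "g \<in> carrier G \<Longrightarrow> inj_on (\<lambda>t. g <#\<^bsub>G\<^esub> t) S"
proof (rule inj_onI)
  fix s t assume g: "g \<in> carrier G" and st: "s \<in> S" "t \<in> S" and eq: "g <#\<^bsub>G\<^esub> s = g <#\<^bsub>G\<^esub> t"
  have "inv g <#\<^bsub>G\<^esub> (g <#\<^bsub>G\<^esub> r) = r" if "r \<in> S" for r
    using act_mult[OF inv_closed[OF g] g that] act_coset[OF one_closed that]
      sec_coset[OF that, symmetric] sec_carrier[OF that] g by simp
  then show "s = t" using st eq by metis
qed

end

section \<open>The induced map, its defect and its distance from the identity\<close>

locale extension_approx = coset_section +
  fixes \<phi> :: "'a \<Rightarrow> nat \<Rightarrow> nat \<Rightarrow> complex" and N :: nat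
    and \<sigma> :: "'a \<Rightarrow> 'a set \<Rightarrow> 'a set"
  assumes inv: "\<And>k. k \<in> H \<Longrightarrow> left_invertible_on {..<N} (\<phi> k)"
    and \<sigma>_bij: "\<And>g. g \<in> carrier G \<Longrightarrow> bij_betw (\<sigma> g) S S"
    and \<sigma>: "\<And>g t. g \<in> carrier G \<Longrightarrow> t \<in> S \<Longrightarrow> g <#\<^bsub>G\<^esub> t \<in> S \<Longrightarrow> \<sigma> g t = g <#\<^bsub>G\<^esub> t"
begin

text \<open>The value outside \<open>H\<close> is a default: where translation leaves
  \<open>S\<close>, \<sigma> is an arbitrary completion, so cocycle values outside \<open>H\<close>
  may occur, and \<open>Phi g\<close> has to be invertible there too.\<close>

definition conj_fac :: "'a \<Rightarrow> 'a set \<Rightarrow> bool \<times> nat \<Rightarrow> bool \<times> nat \<Rightarrow> complex" where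
  "conj_fac k u = one_oplus (if k \<in> H then \<phi> (sec u \<otimes> k \<otimes> inv (sec u)) else id_fun_mat)"

abbreviation "Y \<equiv> UNIV \<times> {..<N} :: (bool \<times> nat) set"
abbreviation "Z \<equiv> tuples S Y"

definition Psi :: "'a \<Rightarrow> ('a set \<Rightarrow> bool \<times> nat) \<Rightarrow> ('a set \<Rightarrow> bool \<times> nat) \<Rightarrow> complex" where
  "Psi k = tensor S (conj_fac k)"

text \<open>The monomial block matrix of an induced representation. Letting \<sigma> permute all of
  \<open>S\<close>, even where translation leaves \<open>S\<close>, makes it invertible for every
  \<open>g\<close>.\<close>

definition Phi ::
  "'a \<Rightarrow> 'a set \<times> ('a set \<Rightarrow> bool \<times> nat) \<Rightarrow> 'a set \<times> ('a set \<Rightarrow> bool \<times> nat) \<Rightarrow> complex" where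
  "Phi g = (\<lambda>(s, z) (t, w). if s = \<sigma> g t then Psi (cocycle g s t) z w else 0)"

lemma finZ: "finite Z" by (simp add: finite_PiE finS)

lemma conj_fac_inv: "u \<in> S \<Longrightarrow> left_invertible_on Y (conj_fac k u)"
proof -
  assume u: "u \<in> S"
  let ?A = "if k \<in> H then \<phi> (sec u \<otimes> k \<otimes> inv (sec u)) else id_fun_mat"
  have "left_invertible_on {..<N} ?A"
    using inv conj_mem[OF u] left_invertible_on_id[of "{..<N}"] by auto
  then obtain B where B: "\<forall>x\<in>{..<N}. \<forall>y\<in>{..<N}. matmul {..<N} B ?A x y = id_fun_mat x y"
    unfolding left_invertible_on_def by (elim exE)
  have "matmul Y (one_oplus B) (conj_fac k u) p q = id_fun_mat p q" if pq: "p \<in> Y" "q \<in> Y" for p q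
  proof -
    have "matmul Y (one_oplus B) (conj_fac k u) p q = one_oplus (matmul {..<N} B ?A) p q"
      unfolding conj_fac_def by (rule one_oplus_matmul[OF _ pq]) simp
    also have "\<dots> = one_oplus id_fun_mat p q"
      using B pq by (auto simp: one_oplus_def)
    finally show ?thesis by (simp add: one_oplus_id)
  qed
  then show ?thesis unfolding left_invertible_on_def by (intro exI[of _ "one_oplus B"]) simp
qed

lemma conj_fac_inverses:
  "\<exists>L. \<forall>u\<in>S. \<forall>p\<in>Y. \<forall>q\<in>Y. matmul Y (L u) (conj_fac k u) p q = id_fun_mat p q"
proof -
  have "\<forall>u. \<exists>L. u \<in> S \<longrightarrow> (\<forall>p\<in>Y. \<forall>q\<in>Y. matmul Y L (conj_fac k u) p q = id_fun_mat p q)"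
    using conj_fac_inv unfolding left_invertible_on_def by simp
  then obtain L where "\<forall>u. u \<in> S \<longrightarrow> (\<forall>p\<in>Y. \<forall>q\<in>Y. matmul Y (L u) (conj_fac k u) p q = id_fun_mat p q)"
    unfolding choice_iff by (elim exE)
  then show ?thesis by (intro exI[of _ L]) blast
qed

lemma Psi_inv: "left_invertible_on Z (Psi k)"
proof -
  obtain L where L: "\<forall>u\<in>S. \<forall>p\<in>Y. \<forall>q\<in>Y. matmul Y (L u) (conj_fac k u) p q = id_fun_mat p q"
    using conj_fac_inverses[of k] by (elim exE)
  have "matmul Z (tensor S L) (Psi k) x y = id_fun_mat x y" if xy: "x \<in> Z" "y \<in> Z" for x y
  proof -
    have "matmul Z (tensor S L) (Psi k) x y = tensor S (\<lambda>u. matmul Y (L u) (conj_fac k u)) x y"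
      unfolding Psi_def by (subst tensor_matmul) (simp_all add: finS)
    also have "\<dots> = tensor S (\<lambda>_. id_fun_mat) x y"
      by (rule tensor_cong[OF _ xy]) (rule L[rule_format])
    also have "\<dots> = id_fun_mat x y" by (rule tensor_id[OF finS xy])
    finally show ?thesis .
  qed
  then show ?thesis unfolding left_invertible_on_def by (intro exI[of _ "tensor S L"]) simp
qed

lemma Phi_inv:
  assumes g: "g \<in> carrier G"
  shows "left_invertible_on (S \<times> Z) (Phi g)"
proof -
  have "\<forall>k. \<exists>B. \<forall>x\<in>Z. \<forall>y\<in>Z. matmul Z B (Psi k) x y = id_fun_mat x y"
    using Psi_inv unfolding left_invertible_on_def by blast
  then obtain B where B: "\<forall>k. \<forall>x\<in>Z. \<forall>y\<in>Z. matmul Z (B k) (Psi k) x y = id_fun_mat x y"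
    unfolding choice_iff by (elim exE)
  \<comment> \<open>The inverse moves the blocks back and inverts each of them.\<close>
  define C where "C = (\<lambda>(t, w) (s, z). if s = \<sigma> g t then B (cocycle g s t) w z else 0)"
  have "matmul (S \<times> Z) C (Phi g) p q = id_fun_mat p q" if pq: "p \<in> S \<times> Z" "q \<in> S \<times> Z" for p q
  proof -
    obtain t w t' w' where tw: "p = (t, w)" "q = (t', w')" "t \<in> S" "w \<in> Z" "t' \<in> S" "w' \<in> Z"
      using pq by blast
    have st: "\<sigma> g t \<in> S" using \<sigma>_bij[OF g] tw by (auto simp: bij_betw_def)
    have inj: "\<sigma> g t = \<sigma> g t' \<longleftrightarrow> t = t'" using \<sigma>_bij[OF g] tw by (auto simp: bij_betw_def dest: inj_onD)
    have "matmul (S \<times> Z) C (Phi g) p q = (\<Sum>s\<in>S. \<Sum>z\<in>Z. C p (s, z) * Phi g (s, z) q)"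
      unfolding matmul_def by (rule sum_over_Times)
    also have "\<dots> = (\<Sum>s\<in>S. if s = \<sigma> g t then (\<Sum>z\<in>Z. C p (s, z) * Phi g (s, z) q) else 0)"
      by (intro sum.cong refl) (simp add: C_def tw)
    also have "\<dots> = (\<Sum>z\<in>Z. C p (\<sigma> g t, z) * Phi g (\<sigma> g t, z) q)"
      using finS st by simp
    also have "\<dots> = (if t = t' then matmul Z (B (cocycle g (\<sigma> g t) t)) (Psi (cocycle g (\<sigma> g t) t)) w w' else 0)"
      unfolding matmul_def by (simp add: C_def Phi_def tw inj)
    also have "\<dots> = id_fun_mat p q" using B tw by (simp add: id_fun_mat_def)
    finally show ?thesis .
  qed
  then show ?thesis unfolding left_invertible_on_def by (intro exI[of _ C]) simp
qed

text \<open>Conjugation by \<open>sec u\<close> is multiplicative, so the factor at \<open>u\<close>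
  inherits the defect of \<phi> at the conjugated pair; the tensor product adds these defects over
  \<open>u\<close>.\<close>

lemma Psi_mult_rank_le:
  assumes k: "k \<in> H" "k' \<in> H"
    and r: "\<And>u. u \<in> S \<Longrightarrow> rank_le {..<N} {..<N}
      (\<lambda>x y. \<phi> ((sec u \<otimes> k \<otimes> inv (sec u)) \<otimes> (sec u \<otimes> k' \<otimes> inv (sec u))) x y -
         matmul {..<N} (\<phi> (sec u \<otimes> k \<otimes> inv (sec u))) (\<phi> (sec u \<otimes> k' \<otimes> inv (sec u))) x y) r"
  shows "rank_le Z Z (\<lambda>z w. Psi (k \<otimes> k') z w - matmul Z (Psi k) (Psi k') z w)
      (card S * (r * card Y ^ (card S - 1)))"
proof -
  have mm: "matmul Z (Psi k) (Psi k') = tensor S (\<lambda>u. matmul Y (conj_fac k u) (conj_fac k' u))"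
    unfolding Psi_def by (rule tensor_matmul) (simp_all add: finS)
  show ?thesis unfolding mm unfolding Psi_def
  proof (rule tensor_diff_rank_le)
    fix u assume u: "u \<in> S"
    let ?k = "sec u \<otimes> k \<otimes> inv (sec u)" and ?k' = "sec u \<otimes> k' \<otimes> inv (sec u)"
    have kc: "k \<in> carrier G" "k' \<in> carrier G" "sec u \<in> carrier G"
      using k u sec_carrier subset by auto
    have "?k \<otimes> ?k' = sec u \<otimes> (k \<otimes> ((inv (sec u) \<otimes> sec u) \<otimes> (k' \<otimes> inv (sec u))))"
      using kc by (simp only: m_assoc m_closed inv_closed)
    also have "\<dots> = sec u \<otimes> (k \<otimes> k') \<otimes> inv (sec u)"
      using kc by (simp add: m_assoc)
    finally have kk: "sec u \<otimes> (k \<otimes> k') \<otimes> inv (sec u) = ?k \<otimes> ?k'" by simp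
    have "rank_le Y Y (\<lambda>p q. one_oplus (\<phi> (?k \<otimes> ?k')) p q -
        one_oplus (matmul {..<N} (\<phi> ?k) (\<phi> ?k')) p q) r"
      by (rule one_oplus_diff_rank_le[OF r[OF u]])
    then show "rank_le Y Y (\<lambda>p q. conj_fac (k \<otimes> k') u p q - matmul Y (conj_fac k u) (conj_fac k' u) p q) r"
    proof (rule rank_le_cong)
      fix p q assume pq: "p \<in> Y" "q \<in> Y"
      have "matmul Y (conj_fac k u) (conj_fac k' u) p q = one_oplus (matmul {..<N} (\<phi> ?k) (\<phi> ?k')) p q"
        unfolding conj_fac_def using k one_oplus_matmul[OF finite_lessThan pq] by simp
      moreover have "conj_fac (k \<otimes> k') u = one_oplus (\<phi> (?k \<otimes> ?k'))"
        unfolding conj_fac_def kk[symmetric] using k by simp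
      ultimately show "one_oplus (\<phi> (?k \<otimes> ?k')) p q - one_oplus (matmul {..<N} (\<phi> ?k) (\<phi> ?k')) p q =
        conj_fac (k \<otimes> k') u p q - matmul Y (conj_fac k u) (conj_fac k' u) p q" by simp
    qed
  qed (simp_all add: finS)
qed

text \<open>If \<open>h\<close> and \<open>g \<otimes> h\<close> both keep the coset
  \<open>t\<close> in \<open>S\<close>, the permutations compose correctly at \<open>t\<close> and
  the cocycle identity reduces the column block to the defect of \<open>Psi\<close>. The other
  column blocks, at most \<open>b\<close>, are bounded by their width.\<close>

lemma Phi_mult_rank_le:
  assumes gh: "g \<in> carrier G" "h \<in> carrier G"
    and r: "\<And>k k' u. u \<in> S \<Longrightarrow> k \<in> H \<Longrightarrow> k' \<in> H \<Longrightarrow>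
      k \<in> (\<lambda>(s, t). cocycle g s t) ` (S \<times> S) \<Longrightarrow> k' \<in> (\<lambda>(s, t). cocycle h s t) ` (S \<times> S) \<Longrightarrow>
      rank_le {..<N} {..<N}
      (\<lambda>x y. \<phi> ((sec u \<otimes> k \<otimes> inv (sec u)) \<otimes> (sec u \<otimes> k' \<otimes> inv (sec u))) x y -
         matmul {..<N} (\<phi> (sec u \<otimes> k \<otimes> inv (sec u))) (\<phi> (sec u \<otimes> k' \<otimes> inv (sec u))) x y) r"
    and bad: "card {t\<in>S. \<not> (h <#\<^bsub>G\<^esub> t \<in> S \<and> (g \<otimes> h) <#\<^bsub>G\<^esub> t \<in> S)} \<le> b"
  shows "rank_le (S \<times> Z) (S \<times> Z) (\<lambda>x y. Phi (g \<otimes> h) x y - matmul (S \<times> Z) (Phi g) (Phi h) x y)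
      (card S * (card S * (r * card Y ^ (card S - 1))) + b * card Z)"
proof -
  let ?good = "\<lambda>t. h <#\<^bsub>G\<^esub> t \<in> S \<and> (g \<otimes> h) <#\<^bsub>G\<^esub> t \<in> S"
  let ?c = "card S * (r * card Y ^ (card S - 1))"
  have col: "rank_le (S \<times> Z) Z (\<lambda>x w. Phi (g \<otimes> h) x (t, w) - matmul (S \<times> Z) (Phi g) (Phi h) x (t, w)) ?c"
    if t: "t \<in> S" "?good t" for t
  proof -
    define s where "s = h <#\<^bsub>G\<^esub> t"
    define q where "q = (g \<otimes> h) <#\<^bsub>G\<^esub> t"
    have q: "q = g <#\<^bsub>G\<^esub> s" unfolding q_def s_def using act_mult gh t by simp
    have sq: "s \<in> S" "q \<in> S" using t by (auto simp: s_def q_def)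
    have sig: "\<sigma> h t = s" "\<sigma> (g \<otimes> h) t = q" "\<sigma> g s = q"
      using \<sigma>[of h t] \<sigma>[of "g \<otimes> h" t] \<sigma>[of g s] gh t sq q by (auto simp: s_def q_def)
    let ?k = "cocycle g q s" and ?k' = "cocycle h s t"
    have k: "?k \<in> H" "?k' \<in> H"
      using cocycle_mem[of g s] cocycle_mem[of h t] gh t sq q s_def by auto
    have kk: "cocycle (g \<otimes> h) q t = ?k \<otimes> ?k'" by (rule cocycle_mult) (use gh t sq in auto)
    have "rank_le Z Z (\<lambda>z w. Psi (?k \<otimes> ?k') z w - matmul Z (Psi ?k) (Psi ?k') z w) ?c"
      by (rule Psi_mult_rank_le[OF k]) (intro r k; use sq t in auto)
    \<comment> \<open>This inclusion puts the defect of \<open>Psi\<close> into block row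
      \<open>q\<close>; the other rows of the column block are zero.\<close>
    then have "rank_le (S \<times> Z) Z (matmul Z (\<lambda>x z. if fst x = q then id_fun_mat (snd x) z else 0)
       (\<lambda>z w. Psi (?k \<otimes> ?k') z w - matmul Z (Psi ?k) (Psi ?k') z w)) ?c"
      by (rule rank_le_matmul_left)
    then show ?thesis
    proof (rule rank_le_cong)
      fix x w assume "x \<in> S \<times> Z" "w \<in> Z"
      then obtain a z where az: "x = (a, z)" "a \<in> S" "z \<in> Z" by blast
      have "matmul (S \<times> Z) (Phi g) (Phi h) x (t, w)
          = (\<Sum>a'\<in>S. \<Sum>z'\<in>Z. Phi g x (a', z') * Phi h (a', z') (t, w))"
        unfolding matmul_def by (rule sum_over_Times)
      also have "\<dots> = (\<Sum>a'\<in>S. if a' = s then \<Sum>z'\<in>Z. Phi g x (s, z') * Phi h (s, z') (t, w) else 0)"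
        by (intro sum.cong refl) (simp add: Phi_def sig)
      also have "\<dots> = (\<Sum>z'\<in>Z. Phi g x (s, z') * Phi h (s, z') (t, w))"
        using finS sq by simp
      also have "\<dots> = (if a = q then matmul Z (Psi ?k) (Psi ?k') z w else 0)"
        by (simp add: Phi_def sig az matmul_def)
      finally have "Phi (g \<otimes> h) x (t, w) - matmul (S \<times> Z) (Phi g) (Phi h) x (t, w) =
        (if a = q then Psi (?k \<otimes> ?k') z w - matmul Z (Psi ?k) (Psi ?k') z w else 0)"
        by (simp add: Phi_def sig az kk)
      moreover have "matmul Z (\<lambda>x z. if fst x = q then id_fun_mat (snd x) z else 0)
         (\<lambda>z w. Psi (?k \<otimes> ?k') z w - matmul Z (Psi ?k) (Psi ?k') z w) x w =
        (if a = q then Psi (?k \<otimes> ?k') z w - matmul Z (Psi ?k) (Psi ?k') z w else 0)"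
        unfolding matmul_def[of Z "\<lambda>x z. if fst x = q then id_fun_mat (snd x) z else 0"]
        using az id_fun_mat_sum(1)[OF finZ, of z "\<lambda>z. Psi (?k \<otimes> ?k') z w - matmul Z (Psi ?k) (Psi ?k') z w"]
        by simp
      ultimately show "matmul Z (\<lambda>x z. if fst x = q then id_fun_mat (snd x) z else 0)
         (\<lambda>z w. Psi (?k \<otimes> ?k') z w - matmul Z (Psi ?k) (Psi ?k') z w) x w =
         Phi (g \<otimes> h) x (t, w) - matmul (S \<times> Z) (Phi g) (Phi h) x (t, w)" by simp
    qed
  qed
  have "rank_le (S \<times> Z) (S \<times> Z) (\<lambda>x y. Phi (g \<otimes> h) x y - matmul (S \<times> Z) (Phi g) (Phi h) x y)
      (\<Sum>t\<in>S. if ?good t then ?c else card Z)"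
    by (rule rank_le_col_blocks[OF finS]) (use col rank_le_card_cols[OF finZ] in auto)
  then show ?thesis
  proof (rule rank_le_mono)
    have "(\<Sum>t\<in>S. if ?good t then ?c else card Z) \<le> (\<Sum>t\<in>S. ?c + (if ?good t then 0 else card Z))"
      by (intro sum_mono) simp
    also have "\<dots> = card S * ?c + (\<Sum>t\<in>S. if ?good t then 0 else card Z)"
      by (simp add: sum.distrib)
    also have "(\<Sum>t\<in>S. if ?good t then 0 else card Z) = (\<Sum>t\<in>{t\<in>S. \<not> ?good t}. card Z)"
      using finS by (intro sum.mono_neutral_cong_right) auto
    also have "\<dots> \<le> b * card Z" using bad by simp
    finally show "(\<Sum>t\<in>S. if ?good t then ?c else card Z) \<le> card S * ?c + b * card Z" by simp
  qed
qed

text \<open>Elements of \<open>H\<close> fix every coset, so \<open>Phi h\<close> is block diagonal.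
  In block \<open>t\<close> the tensor factor at \<open>u = t\<close> undoes the conjugation in the
  cocycle and equals \<open>one_oplus (\<phi> h)\<close>, so every block has the same bound, given
  by \<phi> at \<open>h\<close> itself.\<close>

lemma Phi_rank_ge_in_subgroup:
  assumes h: "h \<in> H" and r: "rank_ge {..<N} {..<N} (\<lambda>x y. \<phi> h x y - id_fun_mat x y) r"
  shows "rank_ge (S \<times> Z) (S \<times> Z) (\<lambda>x y. Phi h x y - id_fun_mat x y) (card S * (card Y ^ (card S - 1) * r))"
proof -
  have hc: "h \<in> carrier G" using h subset by blast
  have fixed: "\<sigma> h t = t" if t: "t \<in> S" for t
  proof -
    have "h <#\<^bsub>G\<^esub> t = H #> (h \<otimes> sec t)" by (rule act_coset[OF hc t])
    also have "\<dots> = (H #> h) #> sec t" using coset_mult_assoc[OF subset hc sec_carrier[OF t]] by simp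
    also have "H #> h = H" by (rule rcos_const[OF is_group h])
    also have "H #> sec t = t" by (rule sec_coset[OF t, symmetric])
    finally show ?thesis using \<sigma>[OF hc t] t by simp
  qed
  show ?thesis
  proof (rule rank_ge_blocks[where \<sigma> = "\<lambda>t. t" and T = S
        and M = "\<lambda>t z w. Psi (cocycle h t t) z w - id_fun_mat z w"])
    fix t assume t: "t \<in> S"
    let ?k = "cocycle h t t"
    have tc: "sec t \<in> carrier G" using sec_carrier t .
    have "?k \<in> H" using inv_op_closed1[OF tc h] by (simp add: cocycle_def)
    moreover have "sec t \<otimes> ?k \<otimes> inv (sec t) = h"
    proof -
      have "sec t \<otimes> ?k \<otimes> inv (sec t) = (sec t \<otimes> inv (sec t)) \<otimes> (h \<otimes> (sec t \<otimes> inv (sec t)))"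
        using tc hc by (simp only: cocycle_def m_assoc m_closed inv_closed)
      then show ?thesis using tc hc by simp
    qed
    ultimately have D: "conj_fac ?k t = one_oplus (\<phi> h)" by (simp add: conj_fac_def)
    obtain L where L: "\<forall>u\<in>S. \<forall>p\<in>Y. \<forall>q\<in>Y. matmul Y (L u) (conj_fac ?k u) p q = id_fun_mat p q"
      using conj_fac_inverses[of ?k] by (elim exE)
    show "rank_ge Z Z (\<lambda>z w. Psi ?k z w - id_fun_mat z w) (card Y ^ (card S - 1) * r)"
      unfolding Psi_def
      by (rule tensor_minus_id_rank_ge[where L = L and D = "conj_fac ?k", OF finS finite_lessThan t D r])
         (rule L[rule_format])
  next
    fix t t' z z' assume "t \<in> S" "t' \<in> S"
    then show "Phi h (t, z) (t', z') - id_fun_mat (t, z) (t', z') =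
       (if t = t' then Psi (cocycle h t t) z z' - id_fun_mat z z' else 0)"
      by (simp add: Phi_def fixed id_fun_mat_def)
  qed (use finS finZ in auto)
qed

text \<open>In rows over \<sigma> g t and columns over t', with t and t' in \<open>T\<close>, the
  identity has only zero entries because \<open>T\<close> is disjoint from its image; what remains
  is a permuted family of invertible blocks.\<close>

lemma Phi_rank_ge_outside:
  assumes g: "g \<in> carrier G" and T: "T \<subseteq> S" "\<sigma> g ` T \<inter> T = {}"
  shows "rank_ge (S \<times> Z) (S \<times> Z) (\<lambda>x y. Phi g x y - id_fun_mat x y) (card T * card Z)"
proof (rule rank_ge_blocks[where \<sigma> = "\<sigma> g" and T = T and M = "\<lambda>t. Psi (cocycle g (\<sigma> g t) t)"])
  have bij: "inj_on (\<sigma> g) S" "\<sigma> g ` S = S" using \<sigma>_bij[OF g] by (auto simp: bij_betw_def)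
  then show inj: "inj_on (\<sigma> g) T" and "\<sigma> g ` T \<subseteq> S" using T(1) by (auto intro: inj_on_subset)
  fix t t' z z' assume t: "t \<in> T" "t' \<in> T"
  have "\<sigma> g t \<noteq> t'" using T(2) t by blast
  moreover have "\<sigma> g t = \<sigma> g t' \<longleftrightarrow> t = t'" using inj t by (auto dest: inj_onD)
  ultimately show "Phi g (\<sigma> g t, z) (t', z') - id_fun_mat (\<sigma> g t, z) (t', z') =
       (if t = t' then Psi (cocycle g (\<sigma> g t) t) z z' else 0)"
    by (simp add: Phi_def id_fun_mat_def)
next
  fix t
  show "rank_ge Z Z (Psi (cocycle g (\<sigma> g t) t)) (card Z)"
    by (rule rank_ge_left_invertible[OF finZ Psi_inv])
qed (use finS finZ T in auto)

text \<open>Cancelling the representative shows that only elements of \<open>H\<close> fix a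
  coset.\<close>

lemma moved_outside:
  assumes g: "g \<in> carrier G" "g \<notin> H" and t: "t \<in> S" "g <#\<^bsub>G\<^esub> t \<in> S"
  shows "\<sigma> g t \<noteq> t"
proof
  assume "\<sigma> g t = t"
  then have eq: "H #> (g \<otimes> sec t) = t" using \<sigma>[OF g(1) t] act_coset[OF g(1) t(1)] by simp
  have tc: "sec t \<in> carrier G" by (rule sec_carrier[OF t(1)])
  have "g \<otimes> sec t \<in> H #> (g \<otimes> sec t)" by (rule rcos_self) (use g tc is_subgroup in auto)
  then have "g \<otimes> sec t \<in> H #> sec t" unfolding eq sec_coset[OF t(1), symmetric] .
  then obtain h where "h \<in> H" "g \<otimes> sec t = h \<otimes> sec t" by (auto simp: r_coset_def)
  then show False using g tc subset by (metis r_cancel subsetD)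
qed

end

section \<open>Finite injections\<close>

lemma disjoint_from_image:
  assumes fin: "finite A" and inj: "inj_on f A" and mv: "\<And>a. a \<in> A \<Longrightarrow> f a \<noteq> a"
  obtains T where "T \<subseteq> A" "f ` T \<inter> T = {}" "card A \<le> 3 * card T"
proof -
  let ?F = "{T. T \<subseteq> A \<and> f ` T \<inter> T = {}}"
  have "finite ?F" "?F \<noteq> {}" using fin by auto
  from finite_has_maximal[OF this] obtain T where "T \<in> ?F" and max0: "\<forall>U\<in>?F. T \<subseteq> U \<longrightarrow> T = U"
    by (elim bexE)
  then have T: "T \<subseteq> A" "f ` T \<inter> T = {}" by simp_all
  have max: "U = T" if "U \<subseteq> A" "f ` U \<inter> U = {}" "T \<subseteq> U" for U
    by (rule sym, rule max0[rule_format]) (use that in simp_all)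
  have finT: "finite T" using T fin finite_subset by blast
  \<comment> \<open>By maximality no point can be added to \<open>T\<close>, so every point lies in
    \<open>T\<close>, in its image or in its preimage. Each of the three has at most
    \<open>card T\<close> elements, the preimage by injectivity; hence the factor 3.\<close>
  have "A \<subseteq> T \<union> f ` T \<union> (f -` T \<inter> A)"
  proof
    fix a assume a: "a \<in> A"
    show "a \<in> T \<union> f ` T \<union> (f -` T \<inter> A)"
    proof (rule ccontr)
      assume no: "a \<notin> T \<union> f ` T \<union> (f -` T \<inter> A)"
      then have "f ` insert a T \<inter> insert a T = {}" using T(2) mv[OF a] a by auto
      then have "insert a T = T" using max[of "insert a T"] T(1) a by blast
      then show False using no by blast
    qed
  qed
  then have "card A \<le> card (T \<union> f ` T \<union> (f -` T \<inter> A))"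
    using fin finT by (intro card_mono) auto
  also have "\<dots> \<le> card T + card (f ` T) + card (f -` T \<inter> A)"
    by (meson add_le_mono1 card_Un_le order_trans)
  also have "card (f ` T) \<le> card T" using finT by (rule card_image_le)
  also have "card (f -` T \<inter> A) \<le> card T"
    using inj finT by (intro card_inj_on_le[of f]) (auto intro: inj_on_subset)
  finally have "card A \<le> 3 * card T" by simp
  then show thesis using that T by blast
qed


lemma rank_ge_mono: "rank_ge Xs Ys A r \<Longrightarrow> s \<le> r \<Longrightarrow> rank_ge Xs Ys A s"
  unfolding rank_ge_def by (meson less_le_trans)

text \<open>The complements of domain and image in the finite set \<open>S\<close> have the same
  size, so any bijection between them completes the map.\<close>

lemma extend_partial_injection:
  assumes fin: "finite S" and A: "A \<subseteq> S" "inj_on f A" "f ` A \<subseteq> S"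
  shows "\<exists>\<sigma>. bij_betw \<sigma> S S \<and> (\<forall>a\<in>A. \<sigma> a = f a)"
proof -
  have "card (f ` A) = card A" by (rule card_image[OF A(2)])
  then have "card (S - A) = card (S - f ` A)"
    using fin A by (simp add: card_Diff_subset finite_subset)
  then obtain g where g: "bij_betw g (S - A) (S - f ` A)"
    using finite_same_card_bij[of "S - A" "S - f ` A"] fin by auto
  let ?s = "\<lambda>a. if a \<in> A then f a else g a"
  have "bij_betw ?s (A \<union> (S - A)) (f ` A \<union> (S - f ` A))"
  proof (rule bij_betw_combine)
    show "bij_betw ?s A (f ` A)" using A(2) by (auto simp: bij_betw_def inj_on_def)
    show "bij_betw ?s (S - A) (S - f ` A)" by (subst bij_betw_cong[of _ _ g]) (use g in auto)
  qed auto
  moreover have "A \<union> (S - A) = S" "f ` A \<union> (S - f ` A) = S" using A by auto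
  ultimately show ?thesis by (intro exI[of _ ?s]) simp
qed

text \<open>Order of choices: \<open>F\<close> and \<epsilon> determine the Foelner set
  \<open>S\<close>; only then is a map on \<open>H\<close> requested, good on the finitely many
  conjugated cocycle values and precise enough to pay for \<open>card S\<close> tensor
  factors.\<close>

lemma rank_approximable_extension:
  fixes G (structure) and \<delta> :: "'a \<Rightarrow> real"
  assumes H: "H \<lhd> G" and ap: "rank_approximable (G\<lparr>carrier := H\<rparr>) \<delta>" and am: "amenable (G Mod H)"
  shows "rank_approximable G (\<lambda>g. if g \<in> H then \<delta> g / 2 else 1 / 6)"
  unfolding rank_approximable_def
proof (intro allI impI)
  fix F :: "'a set" and \<epsilon> :: real and m :: nat
  assume F: "finite F" "F \<subseteq> carrier G" and eps: "\<epsilon> > 0"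
  interpret normal H G by fact
  interpret Q: group "G Mod H" by (rule factorgroup_is_group)
  \<comment> \<open>Multiplicativity at \<open>(g, h)\<close> concerns the translations by
    \<open>h\<close> and by \<open>g \<otimes> h\<close>, so products are included.\<close>
  define F2 where "F2 = F \<union> (\<lambda>(g, h). g \<otimes> h) ` (F \<times> F)"
  have F2: "finite F2" "F2 \<subseteq> carrier G" using F by (auto simp: F2_def)
  \<comment> \<open>Two exceptional sets of proportion \<open>\<epsilon>'\<close> cost at most
    \<open>\<epsilon> / 2\<close>, leaving the other half to the defect of \<phi>. The bound 1/2
    keeps half of \<open>S\<close> inside \<open>S\<close> for elements outside
    \<open>H\<close>.\<close>
  define \<epsilon>' where "\<epsilon>' = min (\<epsilon> / 4) (1 / 2)"
  have eps': "\<epsilon>' > 0" "\<epsilon>' \<le> \<epsilon> / 4" "\<epsilon>' \<le> 1 / 2" using eps by (auto simp: \<epsilon>'_def)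
  obtain S where Sf: "finite S" "S \<subseteq> carrier (G Mod H)" "S \<noteq> {}"
    and fol: "\<And>k. k \<in> (\<lambda>g. H #> g) ` F2 \<Longrightarrow> card ((k <#\<^bsub>G Mod H\<^esub> S) - S) \<le> \<epsilon>' * card S"
  proof (rule Q.folner_if_amenable[OF am, of "(\<lambda>g. H #> g) ` F2" \<epsilon>'])
    show "(\<lambda>g. H #> g) ` F2 \<subseteq> carrier (G Mod H)"
      using F2 by (auto simp: FactGroup_def RCOSETS_def)
  qed (use F2 eps' in auto)
  have SR: "S \<subseteq> rcosets H" using Sf(2) by (simp add: FactGroup_def)
  interpret coset_section H G S by unfold_locales (use Sf SR in auto)
  have bad: "card {t\<in>S. g <#\<^bsub>G\<^esub> t \<notin> S} \<le> \<epsilon>' * card S" if g: "g \<in> F2" for g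
  proof -
    have gc: "g \<in> carrier G" using g F2 by blast
    \<comment> \<open>Translation by \<open>g\<close> is multiplication by its image in the quotient
      and is injective on \<open>S\<close>, so the cosets leaving \<open>S\<close> are counted by
      the Foelner boundary.\<close>
    have "(\<lambda>t. g <#\<^bsub>G\<^esub> t) ` {t\<in>S. g <#\<^bsub>G\<^esub> t \<notin> S} \<subseteq> ((H #> g) <#\<^bsub>G Mod H\<^esub> S) - S"
    proof (rule image_subsetI)
      fix t assume "t \<in> {t\<in>S. g <#\<^bsub>G\<^esub> t \<notin> S}"
      then have t: "t \<in> S" "g <#\<^bsub>G\<^esub> t \<notin> S" by auto
      have "(H #> g) <#> t = g <#\<^bsub>G\<^esub> t"
        using rcos_sum[OF gc sec_carrier[OF t(1)]] act_coset[OF gc t(1)] sec_coset[OF t(1), symmetric] by simp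
      then have "g <#\<^bsub>G\<^esub> t = (H #> g) \<otimes>\<^bsub>G Mod H\<^esub> t" by (simp add: FactGroup_def)
      then show "g <#\<^bsub>G\<^esub> t \<in> ((H #> g) <#\<^bsub>G Mod H\<^esub> S) - S"
        using t unfolding l_coset_def[of "G Mod H"] by auto
    qed
    moreover have "finite ((H #> g) <#\<^bsub>G Mod H\<^esub> S)" using Sf(1) by (simp add: l_coset_def)
    moreover have "inj_on (\<lambda>t. g <#\<^bsub>G\<^esub> t) {t\<in>S. g <#\<^bsub>G\<^esub> t \<notin> S}"
      by (rule inj_on_subset[OF act_inj[OF gc]]) auto
    ultimately have "card {t\<in>S. g <#\<^bsub>G\<^esub> t \<notin> S} \<le> card (((H #> g) <#\<^bsub>G Mod H\<^esub> S) - S)"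
      by (intro card_inj_on_le[of "\<lambda>t. g <#\<^bsub>G\<^esub> t"]) auto
    also have "real \<dots> \<le> \<epsilon>' * card S" using fol g by blast
    finally show ?thesis by simp
  qed
  have "\<exists>\<sigma>. g \<in> carrier G \<longrightarrow> bij_betw \<sigma> S S \<and> (\<forall>t\<in>{t\<in>S. g <#\<^bsub>G\<^esub> t \<in> S}. \<sigma> t = g <#\<^bsub>G\<^esub> t)" for g
  proof (cases "g \<in> carrier G")
    case True
    have "\<exists>\<sigma>. bij_betw \<sigma> S S \<and> (\<forall>t\<in>{t\<in>S. g <#\<^bsub>G\<^esub> t \<in> S}. \<sigma> t = g <#\<^bsub>G\<^esub> t)"
      by (rule extend_partial_injection) (use Sf inj_on_subset[OF act_inj[OF True]] in auto)
    then show ?thesis by blast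
  qed simp
  then have "\<forall>g. \<exists>\<sigma>. g \<in> carrier G \<longrightarrow> bij_betw \<sigma> S S \<and> (\<forall>t\<in>{t\<in>S. g <#\<^bsub>G\<^esub> t \<in> S}. \<sigma> t = g <#\<^bsub>G\<^esub> t)"
    by (rule allI)
  then obtain \<sigma> where \<sigma>: "\<forall>g. g \<in> carrier G \<longrightarrow> bij_betw (\<sigma> g) S S \<and> (\<forall>t\<in>{t\<in>S. g <#\<^bsub>G\<^esub> t \<in> S}. \<sigma> g t = g <#\<^bsub>G\<^esub> t)"
    unfolding choice_iff by (elim exE)
  \<comment> \<open>\<phi> must be good on the conjugates of cocycle values for multiplicativity,
    and on \<open>F \<inter> H\<close> for the lower bound; \<open>W\<close> collects both.\<close>
  define C where "C = (\<lambda>(g, s, t). cocycle g s t) ` (F \<times> S \<times> S) \<inter> H"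
  define W where "W = (\<lambda>(u, k). sec u \<otimes> k \<otimes> inv (sec u)) ` (S \<times> C) \<union> (F \<inter> H)"
  have W: "finite W" "W \<subseteq> H" using F Sf conj_mem by (auto simp: W_def C_def)
  \<comment> \<open>Dividing by \<open>card S\<close> absorbs the \<open>card S\<close> exchanges in
    the tensor product; since each factor has dimension \<open>2 * N\<close>, the resulting share is
    \<open>\<epsilon> / 2\<close>.\<close>
  define \<epsilon>1 where "\<epsilon>1 = \<epsilon> / card S"
  have cS: "card S > 0" using Sf by (simp add: card_gt_0_iff)
  then have e1: "\<epsilon>1 > 0" using eps by (simp add: \<epsilon>1_def)
  obtain N \<phi> where N: "N \<ge> max m 1" and \<phi>: "approx_rep (G\<lparr>carrier := H\<rparr>) \<delta> W \<epsilon>1 {..<N} \<phi>"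
    using ap[unfolded rank_approximable_def, rule_format, of W \<epsilon>1 "max m 1"] W e1 by auto
  interpret extension_approx H G S \<phi> N \<sigma>
    by unfold_locales (use \<phi> \<sigma> in \<open>simp_all add: approx_rep_def\<close>)
  define d where "d = card Y"
  have d: "d = 2 * N" by (simp add: d_def card_cartesian_product)
  have cZ: "card Z = d ^ card S" using Sf by (simp add: card_PiE d_def)
  have dS: "real d ^ card S = real d * real d ^ (card S - 1)"
    using cS by (metis power_eq_if not_gr_zero)
  have tot: "card (S \<times> Z) = card S * d ^ card S" by (simp add: card_cartesian_product cZ)
  have finP: "finite (S \<times> Z)" using Sf finZ by simp
  define r1 where "r1 = nat \<lfloor>\<epsilon>1 * N\<rfloor>"
  have r1: "real r1 \<le> \<epsilon>1 * N" using e1 by (simp add: r1_def)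
  define b where "b = nat \<lfloor>2 * \<epsilon>' * card S\<rfloor>"
  have b: "real b \<le> 2 * \<epsilon>' * card S" using eps' by (simp add: b_def)
  have "approx_rep G (\<lambda>g. if g \<in> H then \<delta> g / 2 else 1 / 6) F \<epsilon> (S \<times> Z) Phi"
    unfolding approx_rep_def
  proof (intro conjI ballI)
    fix g assume "g \<in> carrier G"
    then show "left_invertible_on (S \<times> Z) (Phi g)" by (rule Phi_inv)
  next
    fix g h assume gh: "g \<in> F" "h \<in> F"
    have "rank_le (S \<times> Z) (S \<times> Z) (\<lambda>x y. Phi (g \<otimes> h) x y - matmul (S \<times> Z) (Phi g) (Phi h) x y)
      (card S * (card S * (r1 * card Y ^ (card S - 1))) + b * card Z)"
    proof (rule Phi_mult_rank_le)
      show "g \<in> carrier G" "h \<in> carrier G" using gh F by auto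
    next
      fix k k' u assume u: "u \<in> S" and k: "k \<in> H" "k' \<in> H"
        "k \<in> (\<lambda>(s, t). cocycle g s t) ` (S \<times> S)" "k' \<in> (\<lambda>(s, t). cocycle h s t) ` (S \<times> S)"
      have "k \<in> C" "k' \<in> C" using k gh unfolding C_def by force+
      then have "sec u \<otimes> k \<otimes> inv (sec u) \<in> W" "sec u \<otimes> k' \<otimes> inv (sec u) \<in> W"
        using u unfolding W_def by force+
      then show "rank_le {..<N} {..<N}
        (\<lambda>x y. \<phi> ((sec u \<otimes> k \<otimes> inv (sec u)) \<otimes> (sec u \<otimes> k' \<otimes> inv (sec u))) x y -
         matmul {..<N} (\<phi> (sec u \<otimes> k \<otimes> inv (sec u))) (\<phi> (sec u \<otimes> k' \<otimes> inv (sec u))) x y) r1"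
        using \<phi> unfolding approx_rep_def r1_def by simp
    next
      have "{t\<in>S. \<not> (h <#\<^bsub>G\<^esub> t \<in> S \<and> (g \<otimes> h) <#\<^bsub>G\<^esub> t \<in> S)}
         = {t\<in>S. h <#\<^bsub>G\<^esub> t \<notin> S} \<union> {t\<in>S. (g \<otimes> h) <#\<^bsub>G\<^esub> t \<notin> S}" by auto
      then have "card {t\<in>S. \<not> (h <#\<^bsub>G\<^esub> t \<in> S \<and> (g \<otimes> h) <#\<^bsub>G\<^esub> t \<in> S)}
         \<le> card {t\<in>S. h <#\<^bsub>G\<^esub> t \<notin> S} + card {t\<in>S. (g \<otimes> h) <#\<^bsub>G\<^esub> t \<notin> S}"
        by (simp only: card_Un_le)
      moreover have "h \<in> F2" "g \<otimes> h \<in> F2" using gh by (auto simp: F2_def)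
      ultimately have "real (card {t\<in>S. \<not> (h <#\<^bsub>G\<^esub> t \<in> S \<and> (g \<otimes> h) <#\<^bsub>G\<^esub> t \<in> S)}) \<le> 2 * \<epsilon>' * card S"
        using bad[of h] bad[of "g \<otimes> h"] by linarith
      then show "card {t\<in>S. \<not> (h <#\<^bsub>G\<^esub> t \<in> S \<and> (g \<otimes> h) <#\<^bsub>G\<^esub> t \<in> S)} \<le> b"
        unfolding b_def by linarith
    qed
    then show "rank_le (S \<times> Z) (S \<times> Z) (\<lambda>x y. Phi (g \<otimes> h) x y - matmul (S \<times> Z) (Phi g) (Phi h) x y)
      (nat \<lfloor>\<epsilon> * card (S \<times> Z)\<rfloor>)"
    proof (rule rank_le_mono)
      have "real (card S * (card S * (r1 * d ^ (card S - 1))) + b * d ^ card S)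
         = card S * card S * real d ^ (card S - 1) * r1 + real d ^ card S * b" by simp
      also have "\<dots> \<le> card S * card S * real d ^ (card S - 1) * (\<epsilon>1 * N) + real d ^ card S * (2 * \<epsilon>' * card S)"
        by (intro add_mono mult_left_mono r1 b) simp_all
      also have "card S * card S * real d ^ (card S - 1) * (\<epsilon>1 * N) = \<epsilon> / 2 * card S * real d ^ card S"
        unfolding dS using cS by (simp add: \<epsilon>1_def d field_simps)
      also have "real d ^ card S * (2 * \<epsilon>' * card S) \<le> real d ^ card S * (\<epsilon> / 2 * card S)"
        using eps' by (intro mult_left_mono mult_right_mono) auto
      finally have "real (card S * (card S * (r1 * d ^ (card S - 1))) + b * d ^ card S)
          \<le> \<epsilon> * card (S \<times> Z)" unfolding tot by (simp add: algebra_simps)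
      then show "card S * (card S * (r1 * card Y ^ (card S - 1))) + b * card Z \<le> nat \<lfloor>\<epsilon> * card (S \<times> Z)\<rfloor>"
        unfolding cZ d_def[symmetric] by linarith
    qed
  next
    fix g assume g: "g \<in> F - {\<one>}"
    have gc: "g \<in> carrier G" using g F by auto
    show "rank_ge (S \<times> Z) (S \<times> Z) (\<lambda>x y. Phi g x y - id_fun_mat x y)
      (nat \<lceil>(if g \<in> H then \<delta> g / 2 else 1 / 6) * card (S \<times> Z)\<rceil>)"
    proof (cases "g \<in> H")
      case True
      define r where "r = nat \<lceil>\<delta> g * N\<rceil>"
      have r: "real r \<ge> \<delta> g * N" by (simp add: r_def real_nat_ceiling_ge)
      have "g \<in> W" using True g by (auto simp: W_def)
      then have "rank_ge {..<N} {..<N} (\<lambda>x y. \<phi> g x y - id_fun_mat x y) r"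
        using \<phi> g unfolding approx_rep_def r_def by simp
      from Phi_rank_ge_in_subgroup[OF True this] show ?thesis
      proof (rule rank_ge_mono)
        \<comment> \<open>\<open>dS\<close> splits off one factor \<open>d = 2 * N\<close>, whose 2
          cancels the halving of \<delta>.\<close>
        have "\<delta> g / 2 * card (S \<times> Z) = card S * real d ^ (card S - 1) * (\<delta> g * N)"
          unfolding tot of_nat_mult of_nat_power dS by (simp add: d)
        also have "\<dots> \<le> card S * real d ^ (card S - 1) * r"
          by (intro mult_left_mono r) simp
        also have "\<dots> = real (card S * (d ^ (card S - 1) * r))" by simp
        finally have "\<delta> g / 2 * card (S \<times> Z) \<le> real (card S * (d ^ (card S - 1) * r))" .
        then show "nat \<lceil>(if g \<in> H then \<delta> g / 2 else 1 / 6) * card (S \<times> Z)\<rceil> \<le> card S * (card Y ^ (card S - 1) * r)"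
          using True unfolding d_def[symmetric] by (simp only: if_True) linarith
      qed
    next
      case False
      let ?A = "{t\<in>S. g <#\<^bsub>G\<^esub> t \<in> S}"
      obtain T where T: "T \<subseteq> ?A" "\<sigma> g ` T \<inter> T = {}" "card ?A \<le> 3 * card T"
      proof (rule disjoint_from_image[of ?A "\<sigma> g"])
        show "inj_on (\<sigma> g) ?A" using \<sigma>_bij[OF gc] by (auto simp: bij_betw_def intro: inj_on_subset)
      qed (use Sf moved_outside[OF gc False] in auto)
      have "T \<subseteq> S" using T(1) by auto
      have "?A = S - {t\<in>S. g <#\<^bsub>G\<^esub> t \<notin> S}" by auto
      then have "card ?A = card S - card {t\<in>S. g <#\<^bsub>G\<^esub> t \<notin> S}"
        using Sf by (simp add: card_Diff_subset)
      then have "real (card ?A) \<ge> card S - card {t\<in>S. g <#\<^bsub>G\<^esub> t \<notin> S}" by linarith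
      moreover have "g \<in> F2" using g by (simp add: F2_def)
      moreover have "\<epsilon>' * card S \<le> 1 / 2 * card S" using eps'(3) by (intro mult_right_mono) auto
      \<comment> \<open>At most half of \<open>S\<close> leaves \<open>S\<close>, so
        \<open>?A\<close> is at least half of \<open>S\<close>, and \<open>T\<close> is at least a
        third of \<open>?A\<close>.\<close>
      ultimately have "real (card S) \<le> 6 * card T" using bad[of g] T(3) by linarith
      from Phi_rank_ge_outside[OF gc \<open>T \<subseteq> S\<close> T(2)] show ?thesis
      proof (rule rank_ge_mono)
        have "1 / 6 * real (card (S \<times> Z)) = 1 / 6 * card S * real (card Z)"
          by (simp add: card_cartesian_product)
        also have "\<dots> \<le> card T * real (card Z)"
          using \<open>real (card S) \<le> 6 * card T\<close> by (intro mult_right_mono) auto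
        finally have "1 / 6 * real (card (S \<times> Z)) \<le> real (card T * card Z)" by simp
        then show "nat \<lceil>(if g \<in> H then \<delta> g / 2 else 1 / 6) * card (S \<times> Z)\<rceil> \<le> card T * card Z"
          using False by (simp only: if_False) linarith
      qed
    qed
  qed
  moreover obtain e where "bij_betw e {..<card (S \<times> Z)} (S \<times> Z)"
    using ex_bij_betw_nat_finite[OF finP] by (auto simp: atLeast0LessThan)
  ultimately have "approx_rep G (\<lambda>g. if g \<in> H then \<delta> g / 2 else 1 / 6) F \<epsilon> {..<card (S \<times> Z)}
    (\<lambda>g x y. Phi g (e x) (e y))"
    by (rule approx_rep_reindex)
  moreover have "m \<le> card (S \<times> Z)"
  proof -
    have "m \<le> d ^ 1" using N d by simp
    also have "\<dots> \<le> d ^ card S" using N d cS by (intro power_increasing) auto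
    also have "\<dots> \<le> card (S \<times> Z)" unfolding tot using cS by simp
    finally show ?thesis .
  qed
  ultimately show "\<exists>n\<ge>m. \<exists>\<phi>. approx_rep G (\<lambda>g. if g \<in> H then \<delta> g / 2 else 1 / 6) F \<epsilon> {..<n} \<phi>"
    by blast
qed


section \<open>Ultraproducts\<close>

lemma vec_space_rank_le_iff:
  fixes M :: "complex mat"
  assumes "M \<in> carrier_mat n m"
  shows "vec_space.rank n M \<le> r \<longleftrightarrow> rank_le {..<n} {..<m} (\<lambda>i j. M $$ (i, j)) r"
  using vec_space_rank_le[OF assms] rank_le_mono[OF rank_le_vec_space_rank[OF assms]] by blast

lemma matmul_mat_index:
  assumes "M \<in> carrier_mat n m" "K \<in> carrier_mat m l" "i < n" "j < l"
  shows "matmul {..<m} (\<lambda>i j. M $$ (i, j)) (\<lambda>i j. K $$ (i, j)) i j = (M * K) $$ (i, j)"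
  using assms by (simp add: matmul_def scalar_prod_def atLeast0LessThan)

lemma vec_space_rank_mult_le:
  fixes M K :: "complex mat"
  assumes M: "M \<in> carrier_mat n n" and K: "K \<in> carrier_mat n n"
  shows "vec_space.rank n (M * K) \<le> vec_space.rank n M"
    and "vec_space.rank n (M * K) \<le> vec_space.rank n K"
proof -
  have MK: "M * K \<in> carrier_mat n n" using M K by simp
  have eq: "matmul {..<n} (\<lambda>i j. M $$ (i, j)) (\<lambda>i j. K $$ (i, j)) i j = (M * K) $$ (i, j)"
    if "i \<in> {..<n}" "j \<in> {..<n}" for i j
    using matmul_mat_index[OF M K] that by simp
  show "vec_space.rank n (M * K) \<le> vec_space.rank n M"
    unfolding vec_space_rank_le_iff[OF MK]
    by (rule rank_le_cong[OF rank_le_matmul_right[OF rank_le_vec_space_rank[OF M]] eq])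
  show "vec_space.rank n (M * K) \<le> vec_space.rank n K"
    unfolding vec_space_rank_le_iff[OF MK]
    by (rule rank_le_cong[OF rank_le_matmul_left[OF rank_le_vec_space_rank[OF K]] eq])
qed

section \<open>Normalized rank and sequences of invertible matrices\<close>

lemma rho_nonneg: "0 \<le> rho n A"
  by (simp add: rho_def)

lemma rho_mult_le:
  assumes "A \<in> carrier_mat n n" "B \<in> carrier_mat n n"
  shows "rho n (A * B) \<le> rho n A" "rho n (A * B) \<le> rho n B"
  using vec_space_rank_mult_le[OF assms] by (auto simp: rho_def divide_right_mono)

lemma rho_add_le:
  assumes "A \<in> carrier_mat n n" "B \<in> carrier_mat n n"
  shows "rho n (A + B) \<le> rho n A + rho n B"
  using vec_space.rank_subadditive[OF assms]
  by (simp add: rho_def add_divide_distrib[symmetric] divide_right_mono)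

lemma tendsto_0_squeeze:
  fixes f g :: "'c \<Rightarrow> real"
  assumes "(g \<longlongrightarrow> 0) F" "\<And>k. 0 \<le> f k" "\<And>k. f k \<le> g k"
  shows "(f \<longlongrightarrow> 0) F"
  by (rule tendsto_sandwich[OF _ _ tendsto_const assms(1)]) (use assms(2,3) in auto)

lemma GLprod_simps [simp]:
  "a \<in> carrier (GLprod n) \<longleftrightarrow> (\<forall>k. a k \<in> carrier_mat (n k) (n k) \<and> invertible_mat (a k))"
  "a \<otimes>\<^bsub>GLprod n\<^esub> b = (\<lambda>k. a k * b k)"
  "\<one>\<^bsub>GLprod n\<^esub> = (\<lambda>k. 1\<^sub>m (n k))"
  by (simp_all add: GLprod_def)

lemma invertible_mat_iff_left_inverse:
  fixes A :: "'a::field mat"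
  assumes A: "A \<in> carrier_mat n n"
  shows "invertible_mat A \<longleftrightarrow> (\<exists>B\<in>carrier_mat n n. B * A = 1\<^sub>m n)"
proof
  assume "invertible_mat A"
  then obtain B where B: "A * B = 1\<^sub>m n" "B * A = 1\<^sub>m (dim_row B)"
    using A by (auto simp: invertible_mat_def inverts_mat_def)
  have "dim_col (A * B) = n" "dim_col (B * A) = dim_row B" by (simp_all add: B)
  then have "B \<in> carrier_mat n n" using A by auto
  then show "\<exists>B\<in>carrier_mat n n. B * A = 1\<^sub>m n" using B by auto
next
  assume "\<exists>B\<in>carrier_mat n n. B * A = 1\<^sub>m n"
  then obtain B where B: "B \<in> carrier_mat n n" "B * A = 1\<^sub>m n" by blast
  then have "A * B = 1\<^sub>m n" using mat_mult_left_right_inverse[OF B(1) A] by simp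
  then show "invertible_mat A"
    using A B by (auto simp: invertible_mat_def inverts_mat_def)
qed

lemma invertible_mat_one: "invertible_mat (1\<^sub>m m :: 'a::field mat)"
  by (subst invertible_mat_iff_left_inverse[of _ m]) (auto intro!: bexI[of _ "1\<^sub>m m"])

lemma invertible_mat_mult:
  fixes A B :: "'a::field mat"
  assumes A: "A \<in> carrier_mat n n" "invertible_mat A" and B: "B \<in> carrier_mat n n" "invertible_mat B"
  shows "invertible_mat (A * B)"
proof -
  obtain A' where A': "A' \<in> carrier_mat n n" "A' * A = 1\<^sub>m n"
    using A invertible_mat_iff_left_inverse by blast
  obtain B' where B': "B' \<in> carrier_mat n n" "B' * B = 1\<^sub>m n"
    using B invertible_mat_iff_left_inverse by blast
  have "(B' * A') * (A * B) = B' * (A' * (A * B))"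
    by (rule assoc_mult_mat) (use A(1) B(1) A'(1) B'(1) in auto)
  also have "A' * (A * B) = (A' * A) * B"
    by (rule assoc_mult_mat[symmetric]) (use A(1) B(1) A'(1) in auto)
  also have "B' * \<dots> = 1\<^sub>m n" using A' B' B(1) by simp
  finally show ?thesis
    using A(1) B(1) A'(1) B'(1) by (subst invertible_mat_iff_left_inverse[of _ n]) (auto intro!: bexI[of _ "B' * A'"])
qed

lemma group_GLprod: "group (GLprod n)"
proof (rule groupI)
  fix a b assume ab: "a \<in> carrier (GLprod n)" "b \<in> carrier (GLprod n)"
  show "a \<otimes>\<^bsub>GLprod n\<^esub> b \<in> carrier (GLprod n)"
    using ab by (auto intro!: invertible_mat_mult mult_carrier_mat)
next
  show "\<one>\<^bsub>GLprod n\<^esub> \<in> carrier (GLprod n)" by (simp add: invertible_mat_one)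
next
  fix a b c assume "a \<in> carrier (GLprod n)" "b \<in> carrier (GLprod n)" "c \<in> carrier (GLprod n)"
  then show "a \<otimes>\<^bsub>GLprod n\<^esub> b \<otimes>\<^bsub>GLprod n\<^esub> c = a \<otimes>\<^bsub>GLprod n\<^esub> (b \<otimes>\<^bsub>GLprod n\<^esub> c)"
    by (simp add: fun_eq_iff) (metis assoc_mult_mat)
next
  fix a assume a: "a \<in> carrier (GLprod n)"
  then show "\<one>\<^bsub>GLprod n\<^esub> \<otimes>\<^bsub>GLprod n\<^esub> a = a"
    by (simp add: fun_eq_iff) (metis left_mult_one_mat)
  have "\<forall>k. \<exists>B. B \<in> carrier_mat (n k) (n k) \<and> B * a k = 1\<^sub>m (n k)"
    using a invertible_mat_iff_left_inverse by (metis GLprod_simps(1))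
  then obtain b where b: "\<forall>k. b k \<in> carrier_mat (n k) (n k) \<and> b k * a k = 1\<^sub>m (n k)"
    unfolding choice_iff by (elim exE)
  have "invertible_mat (b k)" for k
  proof -
    have "a k * b k = 1\<^sub>m (n k)" using mat_mult_left_right_inverse[of "b k" "n k" "a k"] a b by simp
    then show ?thesis using invertible_mat_iff_left_inverse[of "b k" "n k"] a b by auto
  qed
  then show "\<exists>b\<in>carrier (GLprod n). b \<otimes>\<^bsub>GLprod n\<^esub> a = \<one>\<^bsub>GLprod n\<^esub>"
    using b by (intro bexI[of _ b]) auto
qed

lemma GLprod_inv:
  assumes "a \<in> carrier (GLprod n)"
  shows "(inv\<^bsub>GLprod n\<^esub> a) k \<in> carrier_mat (n k) (n k)"
    "(inv\<^bsub>GLprod n\<^esub> a) k * a k = 1\<^sub>m (n k)" "a k * (inv\<^bsub>GLprod n\<^esub> a) k = 1\<^sub>m (n k)"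
proof -
  interpret group "GLprod n" by (rule group_GLprod)
  show "(inv\<^bsub>GLprod n\<^esub> a) k \<in> carrier_mat (n k) (n k)"
    using inv_closed[OF assms] by (simp del: inv_closed)
  show "(inv\<^bsub>GLprod n\<^esub> a) k * a k = 1\<^sub>m (n k)"
    using fun_cong[OF l_inv[OF assms], of k] by (simp del: l_inv)
  show "a k * (inv\<^bsub>GLprod n\<^esub> a) k = 1\<^sub>m (n k)"
    using fun_cong[OF r_inv[OF assms], of k] by (simp del: r_inv)
qed

lemma rank_null_iff:
  "a \<in> rank_null \<omega> n \<longleftrightarrow> a \<in> carrier (GLprod n) \<and> ((\<lambda>k. rho (n k) (a k - 1\<^sub>m (n k))) \<longlongrightarrow> 0) \<omega>"
  by (simp add: rank_null_def)

text \<open>The normalized rank of \<open>a - 1\<close> is subadditive under products and does not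
  grow under inverses or conjugation: each new difference is a multiple of old ones or a sum of such
  multiples.\<close>

lemma rank_null_normal: "rank_null \<omega> n \<lhd> GLprod n"
proof -
  interpret group "GLprod n" by (rule group_GLprod)
  have mc: "a k \<in> carrier_mat (n k) (n k)" if "a \<in> carrier (GLprod n)" for a k using that by simp
  show ?thesis
  proof (rule normal_invI)
    show "subgroup (rank_null \<omega> n) (GLprod n)"
    proof (rule subgroupI)
      show "rank_null \<omega> n \<subseteq> carrier (GLprod n)" by (auto simp: rank_null_def)
      have z: "1\<^sub>m m - 1\<^sub>m m = (0\<^sub>m m m :: complex mat)" for m by (intro eq_matI) auto
      have "rho m (1\<^sub>m m - 1\<^sub>m m) = 0" for m
        unfolding z rho_def vec_space.rank_0I by simp
      then have "\<one>\<^bsub>GLprod n\<^esub> \<in> rank_null \<omega> n" by (simp add: rank_null_iff invertible_mat_one)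
      then show "rank_null \<omega> n \<noteq> {}" by blast
    next
      fix a assume a: "a \<in> rank_null \<omega> n"
      then have ac: "a \<in> carrier (GLprod n)" by (simp add: rank_null_iff)
      let ?b = "inv\<^bsub>GLprod n\<^esub> a"
      have "rho (n k) (?b k - 1\<^sub>m (n k)) \<le> rho (n k) (a k - 1\<^sub>m (n k))" for k
      proof -
        note b = GLprod_inv[OF ac, of k]
        have "?b k - 1\<^sub>m (n k) = - ?b k * (a k - 1\<^sub>m (n k))"
          using b mc[OF ac, of k]
          by (simp add: mult_minus_distrib_mat[of _ "n k" "n k"]) (intro eq_matI; auto)
        then show ?thesis using rho_mult_le(2)[OF uminus_carrier_mat[OF b(1)] minus_carrier_mat[OF one_carrier_mat], of "a k"] by simp
      qed
      then have "((\<lambda>k. rho (n k) (?b k - 1\<^sub>m (n k))) \<longlongrightarrow> 0) \<omega>"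
        using a by (intro tendsto_0_squeeze[OF _ rho_nonneg]) (auto simp: rank_null_iff)
      then show "?b \<in> rank_null \<omega> n" using inv_closed[OF ac] by (simp only: rank_null_iff)
    next
      fix a b assume ab: "a \<in> rank_null \<omega> n" "b \<in> rank_null \<omega> n"
      then have c: "a \<in> carrier (GLprod n)" "b \<in> carrier (GLprod n)" by (simp_all add: rank_null_iff)
      have "rho (n k) (a k * b k - 1\<^sub>m (n k)) \<le> rho (n k) (a k - 1\<^sub>m (n k)) + rho (n k) (b k - 1\<^sub>m (n k))" for k
      proof -
        note ck = mc[OF c(1), of k] mc[OF c(2), of k]
        have "a k * b k - 1\<^sub>m (n k) = (a k - 1\<^sub>m (n k)) * b k + (b k - 1\<^sub>m (n k))"
          using ck by (simp add: minus_mult_distrib_mat[of _ "n k" "n k"]) (intro eq_matI; simp)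
        then have "rho (n k) (a k * b k - 1\<^sub>m (n k))
            \<le> rho (n k) ((a k - 1\<^sub>m (n k)) * b k) + rho (n k) (b k - 1\<^sub>m (n k))"
          using rho_add_le[OF mult_carrier_mat[OF minus_carrier_mat[OF one_carrier_mat] ck(2)]
              minus_carrier_mat[OF one_carrier_mat]] by simp
        also have "rho (n k) ((a k - 1\<^sub>m (n k)) * b k) \<le> rho (n k) (a k - 1\<^sub>m (n k))"
          by (rule rho_mult_le(1)) (use ck in auto)
        finally show ?thesis by simp
      qed
      moreover have "((\<lambda>k. rho (n k) (a k - 1\<^sub>m (n k)) + rho (n k) (b k - 1\<^sub>m (n k))) \<longlongrightarrow> 0) \<omega>"
        using ab tendsto_add[of _ "0::real" \<omega> _ 0] by (simp add: rank_null_iff)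
      ultimately have "((\<lambda>k. rho (n k) ((a \<otimes>\<^bsub>GLprod n\<^esub> b) k - 1\<^sub>m (n k))) \<longlongrightarrow> 0) \<omega>"
        by (intro tendsto_0_squeeze[OF _ rho_nonneg]) auto
      then show "a \<otimes>\<^bsub>GLprod n\<^esub> b \<in> rank_null \<omega> n" using m_closed[OF c] by (simp only: rank_null_iff)
    qed
  next
    fix x a assume xx: "x \<in> carrier (GLprod n)" and a: "a \<in> rank_null \<omega> n"
    then have ac: "a \<in> carrier (GLprod n)" by (simp add: rank_null_iff)
    let ?y = "inv\<^bsub>GLprod n\<^esub> x"
    have "rho (n k) (x k * a k * ?y k - 1\<^sub>m (n k)) \<le> rho (n k) (a k - 1\<^sub>m (n k))" for k
    proof -
      note y = GLprod_inv[OF xx, of k] and c = mc[OF xx, of k] mc[OF ac, of k]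
      have "x k * a k * ?y k - 1\<^sub>m (n k) = x k * (a k - 1\<^sub>m (n k)) * ?y k"
        using y c by (simp add: mult_minus_distrib_mat[of _ "n k" "n k"] minus_mult_distrib_mat[of _ "n k" "n k"])
      moreover have "rho (n k) (x k * (a k - 1\<^sub>m (n k)) * ?y k) \<le> rho (n k) (x k * (a k - 1\<^sub>m (n k)))"
        by (rule rho_mult_le(1)) (use y c in auto)
      moreover have "rho (n k) (x k * (a k - 1\<^sub>m (n k))) \<le> rho (n k) (a k - 1\<^sub>m (n k))"
        by (rule rho_mult_le(2)) (use y c in auto)
      ultimately show ?thesis by simp
    qed
    then have "((\<lambda>k. rho (n k) ((x \<otimes>\<^bsub>GLprod n\<^esub> a \<otimes>\<^bsub>GLprod n\<^esub> ?y) k - 1\<^sub>m (n k))) \<longlongrightarrow> 0) \<omega>"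
      using a by (intro tendsto_0_squeeze[OF _ rho_nonneg]) (auto simp: rank_null_iff)
    then show "x \<otimes>\<^bsub>GLprod n\<^esub> a \<otimes>\<^bsub>GLprod n\<^esub> ?y \<in> rank_null \<omega> n"
      using m_closed[OF m_closed[OF xx ac] inv_closed[OF xx]] by (simp only: rank_null_iff)
  qed
qed

text \<open>Multiplying by \<open>b\<close> or its inverse does not increase rank, so
  \<open>a b\<inverse> - 1\<close> and \<open>a - b\<close> have equal normalized rank. Equality in
  the quotient thus becomes convergence of the rank distance.\<close>

lemma rank_null_coset_eq_iff:
  assumes a: "a \<in> carrier (GLprod n)" and b: "b \<in> carrier (GLprod n)"
  shows "rank_null \<omega> n #>\<^bsub>GLprod n\<^esub> a = rank_null \<omega> n #>\<^bsub>GLprod n\<^esub> b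
     \<longleftrightarrow> ((\<lambda>k. rho (n k) (a k - b k)) \<longlongrightarrow> 0) \<omega>"
proof -
  interpret normal "rank_null \<omega> n" "GLprod n" by (rule rank_null_normal)
  have ak: "a k \<in> carrier_mat (n k) (n k)" and bk: "b k \<in> carrier_mat (n k) (n k)" for k
    using a b by simp_all
  let ?c = "inv\<^bsub>GLprod n\<^esub> b"
  note c = GLprod_inv[OF b]
  have "rho (n k) (a k * ?c k - 1\<^sub>m (n k)) = rho (n k) (a k - b k)" for k
  proof (rule antisym)
    have "a k * ?c k - 1\<^sub>m (n k) = (a k - b k) * ?c k"
      using c[of k] ak[of k] bk[of k] by (simp add: minus_mult_distrib_mat[of _ "n k" "n k"])
    then show "rho (n k) (a k * ?c k - 1\<^sub>m (n k)) \<le> rho (n k) (a k - b k)"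
      using rho_mult_le(1)[OF minus_carrier_mat[OF bk] c(1)] by simp
    have "(a k * ?c k) * b k = a k" using c[of k] ak[of k] bk[of k]
      by (simp add: assoc_mult_mat[of _ "n k" "n k" _ "n k" _ "n k"])
    then have "a k - b k = (a k * ?c k - 1\<^sub>m (n k)) * b k"
      using c(1)[of k] ak[of k] bk[of k] by (simp add: minus_mult_distrib_mat[of _ "n k" "n k"])
    then show "rho (n k) (a k - b k) \<le> rho (n k) (a k * ?c k - 1\<^sub>m (n k))"
      using rho_mult_le(1)[OF minus_carrier_mat[OF one_carrier_mat] bk[of k]] by simp
  qed
  then have "a \<otimes>\<^bsub>GLprod n\<^esub> ?c \<in> rank_null \<omega> n \<longleftrightarrow> ((\<lambda>k. rho (n k) (a k - b k)) \<longlongrightarrow> 0) \<omega>"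
    using m_closed[OF a inv_closed[OF b]] unfolding rank_null_iff by simp
  moreover have "a \<otimes>\<^bsub>GLprod n\<^esub> ?c \<in> rank_null \<omega> n \<longleftrightarrow> a \<in> rank_null \<omega> n #>\<^bsub>GLprod n\<^esub> b"
    using rcos_module[OF is_group b a] by simp
  moreover have "a \<in> rank_null \<omega> n #>\<^bsub>GLprod n\<^esub> b \<longleftrightarrow>
     rank_null \<omega> n #>\<^bsub>GLprod n\<^esub> a = rank_null \<omega> n #>\<^bsub>GLprod n\<^esub> b"
    using repr_independence[OF _ b is_subgroup, of a] rcos_self[OF a is_subgroup] by auto
  ultimately show ?thesis by blast
qed

text \<open>Representatives of the images are chosen coset by coset; for finite \<open>F\<close> the
  finitely many conditions hold together along \<omega>, so a single index \<open>k\<close> serves.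
  The ultrafilter is returned because the embedding of the larger group reuses it.\<close>

lemma rank_approximable_if_linear_sofic:
  assumes G: "group G" and ls: "linear_sofic G"
  obtains \<omega> \<delta> where "nonprincipal_ultrafilter \<omega>"
    "\<And>g. g \<in> carrier G - {\<one>\<^bsub>G\<^esub>} \<Longrightarrow> \<delta> g > 0" "rank_approximable G \<delta>"
proof -
  interpret G: group G by (rule G)
  obtain \<omega> n f where \<omega>: "nonprincipal_ultrafilter \<omega>" and n: "filterlim n at_top sequentially"
    and f: "f \<in> hom G (GL_ultraproduct \<omega> n)" and inj: "inj_on f (carrier G)"
    using ls unfolding linear_sofic_def by (elim exE conjE)
  have ultra: "\<not> eventually P \<omega> \<Longrightarrow> eventually (\<lambda>x. \<not> P x) \<omega>" and nt: "\<omega> \<noteq> bot" and cof: "\<omega> \<le> cofinite" for P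
    using \<omega> unfolding nonprincipal_ultrafilter_def by blast+
  interpret K: normal "rank_null \<omega> n" "GLprod n" by (rule rank_null_normal)
  let ?K = "rank_null \<omega> n" and ?P = "GLprod n"
  have "\<exists>a. g \<in> carrier G \<longrightarrow> a \<in> carrier ?P \<and> f g = ?K #>\<^bsub>?P\<^esub> a" for g
  proof (cases "g \<in> carrier G")
    case True
    then have "f g \<in> rcosets\<^bsub>?P\<^esub> ?K"
      using f by (auto simp: hom_def GL_ultraproduct_def FactGroup_def)
    then show ?thesis unfolding RCOSETS_def by blast
  qed simp
  then have "\<forall>g. \<exists>a. g \<in> carrier G \<longrightarrow> a \<in> carrier ?P \<and> f g = ?K #>\<^bsub>?P\<^esub> a" by (rule allI)
  then obtain a where "\<forall>g. g \<in> carrier G \<longrightarrow> a g \<in> carrier ?P \<and> f g = ?K #>\<^bsub>?P\<^esub> a g"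
    unfolding choice_iff by (elim exE)
  then have aP: "\<And>g. g \<in> carrier G \<Longrightarrow> a g \<in> carrier ?P"
    and fa: "\<And>g. g \<in> carrier G \<Longrightarrow> f g = ?K #>\<^bsub>?P\<^esub> a g" by blast+
  have ac: "a g k \<in> carrier_mat (n k) (n k)" "invertible_mat (a g k)" if "g \<in> carrier G" for g k
    using aP[OF that] by simp_all
  have mult: "((\<lambda>k. rho (n k) (a (g \<otimes>\<^bsub>G\<^esub> h) k - a g k * a h k)) \<longlongrightarrow> 0) \<omega>"
    if g: "g \<in> carrier G" and h: "h \<in> carrier G" for g h
  proof -
    have "f (g \<otimes>\<^bsub>G\<^esub> h) = f g <#>\<^bsub>?P\<^esub> f h"
      using hom_mult[OF f g h] by (simp add: GL_ultraproduct_def FactGroup_def)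
    then have "?K #>\<^bsub>?P\<^esub> a (g \<otimes>\<^bsub>G\<^esub> h) = ?K #>\<^bsub>?P\<^esub> (a g \<otimes>\<^bsub>?P\<^esub> a h)"
      using K.rcos_sum[OF aP[OF g] aP[OF h]] fa g h G.m_closed by simp
    then have "((\<lambda>k. rho (n k) (a (g \<otimes>\<^bsub>G\<^esub> h) k - (a g \<otimes>\<^bsub>?P\<^esub> a h) k)) \<longlongrightarrow> 0) \<omega>"
      using rank_null_coset_eq_iff[OF aP[OF G.m_closed[OF g h]] K.m_closed[OF aP[OF g] aP[OF h]]] by (simp only:)
    then show ?thesis by simp
  qed
  \<comment> \<open>For a general filter, failure to converge to 0 gives a positive bound only
    frequently; the ultrafilter property makes it hold eventually.\<close>
  have sep: "\<exists>e>0. eventually (\<lambda>k. e \<le> rho (n k) (a g k - 1\<^sub>m (n k))) \<omega>"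
    if g: "g \<in> carrier G - {\<one>\<^bsub>G\<^esub>}" for g
  proof (rule ccontr)
    assume no: "\<not> ?thesis"
    have "((\<lambda>k. rho (n k) (a g k - 1\<^sub>m (n k))) \<longlongrightarrow> 0) \<omega>"
    proof (rule tendstoI)
      fix e :: real assume e: "e > 0"
      then have "\<not> eventually (\<lambda>k. e \<le> rho (n k) (a g k - 1\<^sub>m (n k))) \<omega>" using no by blast
      then have "eventually (\<lambda>k. \<not> e \<le> rho (n k) (a g k - 1\<^sub>m (n k))) \<omega>" by (rule ultra)
      then show "eventually (\<lambda>k. dist (rho (n k) (a g k - 1\<^sub>m (n k))) 0 < e) \<omega>"
        by (rule eventually_mono) (simp add: rho_nonneg dist_real_def)
    qed
    then have "a g \<in> ?K" using aP g by (simp only: rank_null_iff) blast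
    then have "f g = ?K" using fa g K.rcos_const[OF K.is_group] by simp
    moreover have "f \<one>\<^bsub>G\<^esub> = ?K"
      using hom_one[OF f G] K.factorgroup_is_group by (simp add: GL_ultraproduct_def FactGroup_def)
    ultimately have "f g = f \<one>\<^bsub>G\<^esub>" by simp
    then show False using inj_onD[OF inj] g by blast
  qed
  define \<delta> where "\<delta> g = (SOME e. e > 0 \<and> eventually (\<lambda>k. e \<le> rho (n k) (a g k - 1\<^sub>m (n k))) \<omega>)" for g
  have \<delta>: "\<delta> g > 0" "eventually (\<lambda>k. \<delta> g \<le> rho (n k) (a g k - 1\<^sub>m (n k))) \<omega>"
    if "g \<in> carrier G - {\<one>\<^bsub>G\<^esub>}" for g
    using someI_ex[OF sep[OF that]] unfolding \<delta>_def by blast+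
  have "rank_approximable G \<delta>" unfolding rank_approximable_def
  proof (intro allI impI)
    fix F :: "'a set" and \<epsilon> :: real and m :: nat
    assume F: "finite F" "F \<subseteq> carrier G" and eps: "\<epsilon> > 0"
    have "eventually (\<lambda>k. \<forall>g\<in>F. \<forall>h\<in>F. rho (n k) (a (g \<otimes>\<^bsub>G\<^esub> h) k - a g k * a h k) < \<epsilon>) \<omega>"
    proof (intro eventually_ball_finite F(1) ballI)
      fix g h assume "g \<in> F" "h \<in> F"
      then show "eventually (\<lambda>k. rho (n k) (a (g \<otimes>\<^bsub>G\<^esub> h) k - a g k * a h k) < \<epsilon>) \<omega>"
        using order_tendstoD(2)[OF mult[of g h] eps] F by blast
    qed
    moreover have "eventually (\<lambda>k. \<forall>g\<in>F - {\<one>\<^bsub>G\<^esub>}. \<delta> g \<le> rho (n k) (a g k - 1\<^sub>m (n k))) \<omega>"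
      by (intro eventually_ball_finite ballI \<delta>(2)) (use F in auto)
    \<comment> \<open>Nonprincipality makes \<omega> finer than the sequential filter, so dimensions
      become large along \<omega>; the maximum with 1 allows division by the dimension.\<close>
    moreover have "eventually (\<lambda>k. max m 1 \<le> n k) \<omega>"
    proof (rule filter_leD)
      show "\<omega> \<le> sequentially" using cof by (simp only: cofinite_eq_sequentially)
      show "eventually (\<lambda>k. max m 1 \<le> n k) sequentially" using n unfolding filterlim_at_top by blast
    qed
    ultimately have "eventually (\<lambda>k. (\<forall>g\<in>F. \<forall>h\<in>F. rho (n k) (a (g \<otimes>\<^bsub>G\<^esub> h) k - a g k * a h k) < \<epsilon>) \<and>
       (\<forall>g\<in>F - {\<one>\<^bsub>G\<^esub>}. \<delta> g \<le> rho (n k) (a g k - 1\<^sub>m (n k))) \<and> max m 1 \<le> n k) \<omega>"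
      by (intro eventually_conj)
    then obtain k where k: "\<forall>g\<in>F. \<forall>h\<in>F. rho (n k) (a (g \<otimes>\<^bsub>G\<^esub> h) k - a g k * a h k) < \<epsilon>"
       "\<forall>g\<in>F - {\<one>\<^bsub>G\<^esub>}. \<delta> g \<le> rho (n k) (a g k - 1\<^sub>m (n k))" "max m 1 \<le> n k"
      using eventually_happens'[OF nt] by blast
    define N where "N = n k"
    have N: "N > 0" "m \<le> N" using k(3) by (auto simp: N_def)
    define \<phi> where "\<phi> g i j = a g k $$ (i, j)" for g i j
    have "approx_rep G \<delta> F \<epsilon> {..<N} \<phi>" unfolding approx_rep_def
    proof (intro conjI ballI)
      fix g assume g: "g \<in> carrier G"
      obtain B where B: "B \<in> carrier_mat N N" "B * a g k = 1\<^sub>m N"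
        using ac[OF g, of k] invertible_mat_iff_left_inverse unfolding N_def by blast
      show "left_invertible_on {..<N} (\<phi> g)"
        unfolding left_invertible_on_def \<phi>_def
        by (rule exI[of _ "\<lambda>i j. B $$ (i, j)"])
           (use matmul_mat_index[OF B(1) ac(1)[OF g, of k, folded N_def]] B(2) in \<open>auto simp: id_fun_mat_def\<close>)
    next
      fix g h assume gh: "g \<in> F" "h \<in> F"
      then have c: "g \<in> carrier G" "h \<in> carrier G" using F by auto
      let ?M = "a (g \<otimes>\<^bsub>G\<^esub> h) k - a g k * a h k"
      have gk: "a g k \<in> carrier_mat N N" and hk: "a h k \<in> carrier_mat N N"
        and ghk: "a (g \<otimes>\<^bsub>G\<^esub> h) k \<in> carrier_mat N N"
        using ac c G.m_closed unfolding N_def by blast+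
      have M: "?M \<in> carrier_mat N N" using gk hk by auto
      have "real (vec_space.rank N ?M) \<le> \<epsilon> * N"
        using k(1)[rule_format, OF gh] N(1) unfolding N_def[symmetric] rho_def by (simp add: field_simps)
      then have "vec_space.rank N ?M \<le> nat \<lfloor>\<epsilon> * card {..<N}\<rfloor>" by (simp add: le_nat_floor)
      then have "rank_le {..<N} {..<N} (\<lambda>i j. ?M $$ (i, j)) (nat \<lfloor>\<epsilon> * card {..<N}\<rfloor>)"
        by (simp only: vec_space_rank_le_iff[OF M])
      then show "rank_le {..<N} {..<N} (\<lambda>x y. \<phi> (g \<otimes>\<^bsub>G\<^esub> h) x y - matmul {..<N} (\<phi> g) (\<phi> h) x y)
          (nat \<lfloor>\<epsilon> * card {..<N}\<rfloor>)"
      proof (rule rank_le_cong)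
        fix i j assume "i \<in> {..<N}" "j \<in> {..<N}"
        then show "?M $$ (i, j) = \<phi> (g \<otimes>\<^bsub>G\<^esub> h) i j - matmul {..<N} (\<phi> g) (\<phi> h) i j"
          using matmul_mat_index[OF gk hk, of i j] gk hk ghk unfolding \<phi>_def by simp
      qed
    next
      fix g assume g: "g \<in> F - {\<one>\<^bsub>G\<^esub>}"
      have gk: "a g k \<in> carrier_mat N N" using ac g F unfolding N_def by blast
      let ?M = "a g k - 1\<^sub>m N"
      have M: "?M \<in> carrier_mat N N" by auto
      have "\<delta> g * N \<le> vec_space.rank N ?M"
        using k(2)[rule_format, OF g] N(1) unfolding N_def[symmetric] rho_def by (simp add: field_simps)
      then have r: "nat \<lceil>\<delta> g * card {..<N}\<rceil> \<le> vec_space.rank N ?M" by (simp add: nat_le_iff ceiling_le_iff)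
      show "rank_ge {..<N} {..<N} (\<lambda>x y. \<phi> g x y - id_fun_mat x y) (nat \<lceil>\<delta> g * card {..<N}\<rceil>)"
      proof (rule rank_geI)
        fix s assume "rank_le {..<N} {..<N} (\<lambda>x y. \<phi> g x y - id_fun_mat x y) s"
        then have "rank_le {..<N} {..<N} (\<lambda>i j. ?M $$ (i, j)) s"
          by (rule rank_le_cong) (use gk in \<open>auto simp: \<phi>_def id_fun_mat_def\<close>)
        then show "nat \<lceil>\<delta> g * card {..<N}\<rceil> \<le> s"
          using r vec_space_rank_le_iff[OF M] order_trans by blast
      qed auto
    qed
    then show "\<exists>n\<ge>m. \<exists>\<phi>. approx_rep G \<delta> F \<epsilon> {..<n} \<phi>" using N(2) by blast
  qed
  then show thesis using that \<omega> \<delta>(1) by blast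
qed

text \<open>Countability gives an exhaustion by finite sets; approximations on the
  \<open>k\<close>-th set with error \<open>1 / Suc k\<close> have defects tending to 0. The bounds
  \<open>\<delta> g\<close> do not depend on \<open>k\<close>, so no nontrivial element dies in the
  limit.\<close>

lemma linear_sofic_if_rank_approximable:
  fixes G (structure)
  assumes G: "group G" and cnt: "countable (carrier G)" and \<omega>: "nonprincipal_ultrafilter \<omega>"
    and \<delta>: "\<And>g. g \<in> carrier G - {\<one>} \<Longrightarrow> \<delta> g > 0" and ap: "rank_approximable G \<delta>"
  shows "linear_sofic G"
proof -
  interpret group G by (rule G)
  \<comment> \<open>\<open>from_nat_into\<close> repeats elements when the group is finite, so the
    same exhaustion serves both cases.\<close>
  define F where "F k = from_nat_into (carrier G) ` {..k}" for k :: nat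
  have F: "finite (F k)" "F k \<subseteq> carrier G" for k
    using from_nat_into[of "carrier G"] one_closed unfolding F_def by blast+
  have evF: "eventually (\<lambda>k. g \<in> F k) sequentially" if g: "g \<in> carrier G" for g
  proof -
    obtain i where "from_nat_into (carrier G) i = g"
      using from_nat_into_surj[OF cnt g] by blast
    then have "g \<in> F k" if "i \<le> k" for k using that by (auto simp: F_def)
    then show ?thesis by (auto simp: eventually_sequentially)
  qed
  \<comment> \<open>\<open>Suc k \<le> n\<close> makes the dimensions positive and forces them to
    infinity.\<close>
  have "\<forall>k. \<exists>n. Suc k \<le> n \<and> (\<exists>\<phi>. approx_rep G \<delta> (F k) (1 / real (Suc k)) {..<n} \<phi>)"
    using ap[unfolded rank_approximable_def, rule_format, OF F] by simp
  then obtain n where n: "\<forall>k. Suc k \<le> n k \<and> (\<exists>\<phi>. approx_rep G \<delta> (F k) (1 / real (Suc k)) {..<n k} \<phi>)"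
    unfolding choice_iff by (elim exE)
  then have "\<forall>k. \<exists>\<phi>. approx_rep G \<delta> (F k) (1 / real (Suc k)) {..<n k} \<phi>" by blast
  then obtain \<phi> where \<phi>: "\<forall>k. approx_rep G \<delta> (F k) (1 / real (Suc k)) {..<n k} (\<phi> k)"
    unfolding choice_iff by (elim exE)
  have npos: "n k > 0" for k using n by (metis Suc_le_lessD gr0I not_less_zero)
  define a where "a g k = mat (n k) (n k) (\<lambda>(i, j). \<phi> k g i j)" for g k
  have ac: "a g k \<in> carrier_mat (n k) (n k)" for g k by (simp add: a_def)
  have ai: "a g k $$ (i, j) = \<phi> k g i j" if "i \<in> {..<n k}" "j \<in> {..<n k}" for g k i j
    using that by (simp add: a_def)
  let ?P = "GLprod n" and ?K = "rank_null \<omega> n"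
  interpret K: normal ?K ?P by (rule rank_null_normal)
  have aP: "a g \<in> carrier ?P" if g: "g \<in> carrier G" for g
  proof -
    have "invertible_mat (a g k)" for k
    proof -
      have "left_invertible_on {..<n k} (\<phi> k g)" using \<phi> g unfolding approx_rep_def by blast
      then obtain B where B: "\<forall>x\<in>{..<n k}. \<forall>y\<in>{..<n k}. matmul {..<n k} B (\<phi> k g) x y = id_fun_mat x y"
        unfolding left_invertible_on_def by (elim exE)
      let ?B = "mat (n k) (n k) (\<lambda>(i, j). B i j)"
      have "?B * a g k = 1\<^sub>m (n k)"
      proof (rule eq_matI)
        fix i j assume "i < dim_row (1\<^sub>m (n k) :: complex mat)" "j < dim_col (1\<^sub>m (n k) :: complex mat)"
        then have ij: "i < n k" "j < n k" by auto
        have "(?B * a g k) $$ (i, j) = matmul {..<n k} B (\<phi> k g) i j"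
          using ij by (auto simp: matmul_def scalar_prod_def atLeast0LessThan a_def intro!: sum.cong)
        then show "(?B * a g k) $$ (i, j) = 1\<^sub>m (n k) $$ (i, j)"
          using B ij by (simp add: id_fun_mat_def)
      qed (simp_all add: a_def)
      then show ?thesis
        by (subst invertible_mat_iff_left_inverse[OF ac]) (auto intro!: bexI[of _ ?B])
    qed
    then show ?thesis using ac by simp
  qed
  have le: "\<omega> \<le> sequentially" and nt: "\<omega> \<noteq> bot"
    using \<omega> unfolding nonprincipal_ultrafilter_def by (simp_all add: cofinite_eq_sequentially)
  \<comment> \<open>Each pair lies in \<open>F k\<close> for all large \<open>k\<close>, so
    convergence holds along the sequence itself and passes to \<omega>.\<close>
  have mult: "((\<lambda>k. rho (n k) (a (g \<otimes> h) k - a g k * a h k)) \<longlongrightarrow> 0) \<omega>"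
    if g: "g \<in> carrier G" and h: "h \<in> carrier G" for g h
  proof (rule tendsto_mono[OF le], rule tendsto_sandwich[OF _ _ tendsto_const])
    show "eventually (\<lambda>k. 0 \<le> rho (n k) (a (g \<otimes> h) k - a g k * a h k)) sequentially"
      by (simp add: rho_nonneg)
    show "(\<lambda>k. 1 / real (Suc k)) \<longlonglongrightarrow> 0" by (rule LIMSEQ_inverse_real_of_nat[unfolded inverse_eq_divide])
    show "eventually (\<lambda>k. rho (n k) (a (g \<otimes> h) k - a g k * a h k) \<le> 1 / real (Suc k)) sequentially"
      using evF[OF g] evF[OF h]
    proof eventually_elim
      case (elim k)
      let ?M = "a (g \<otimes> h) k - a g k * a h k"
      have M: "?M \<in> carrier_mat (n k) (n k)" using ac[of g k] ac[of h k] by auto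
      have "rank_le {..<n k} {..<n k} (\<lambda>x y. \<phi> k (g \<otimes> h) x y - matmul {..<n k} (\<phi> k g) (\<phi> k h) x y)
          (nat \<lfloor>1 / real (Suc k) * card {..<n k}\<rfloor>)"
        using \<phi> elim unfolding approx_rep_def by blast
      then have "rank_le {..<n k} {..<n k} (\<lambda>i j. ?M $$ (i, j)) (nat \<lfloor>1 / real (Suc k) * card {..<n k}\<rfloor>)"
      proof (rule rank_le_cong)
        fix i j assume ij: "i \<in> {..<n k}" "j \<in> {..<n k}"
        have "matmul {..<n k} (\<phi> k g) (\<phi> k h) i j = matmul {..<n k} (\<lambda>i j. a g k $$ (i, j)) (\<lambda>i j. a h k $$ (i, j)) i j"
          using ij unfolding matmul_def by (intro sum.cong refl) (simp add: ai)
        also have "\<dots> = (a g k * a h k) $$ (i, j)" using matmul_mat_index[OF ac ac] ij by simp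
        finally show "\<phi> k (g \<otimes> h) i j - matmul {..<n k} (\<phi> k g) (\<phi> k h) i j = ?M $$ (i, j)"
          using ij ac[of g k] ac[of h k] ai[OF ij, of "g \<otimes> h"] by simp
      qed
      then have "vec_space.rank (n k) ?M \<le> nat \<lfloor>1 / real (Suc k) * n k\<rfloor>"
        unfolding vec_space_rank_le_iff[OF M] by simp
      also have "real \<dots> \<le> 1 / real (Suc k) * n k" by (rule of_nat_floor) simp
      finally have "real (vec_space.rank (n k) ?M) \<le> 1 / real (Suc k) * n k" by simp
      then show ?case using npos[of k] unfolding rho_def by (simp add: pos_divide_le_eq)
    qed
  qed
  have sep: "\<not> ((\<lambda>k. rho (n k) (a g k - 1\<^sub>m (n k))) \<longlongrightarrow> 0) \<omega>" if g: "g \<in> carrier G - {\<one>}" for g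
  proof
    assume lim: "((\<lambda>k. rho (n k) (a g k - 1\<^sub>m (n k))) \<longlongrightarrow> 0) \<omega>"
    have "eventually (\<lambda>k. g \<in> F k) \<omega>" using filter_leD[OF le evF] g by blast
    moreover have "eventually (\<lambda>k. rho (n k) (a g k - 1\<^sub>m (n k)) < \<delta> g) \<omega>"
      by (rule order_tendstoD(2)[OF lim \<delta>[OF g]])
    ultimately have "eventually (\<lambda>k. g \<in> F k \<and> rho (n k) (a g k - 1\<^sub>m (n k)) < \<delta> g) \<omega>"
      by (rule eventually_conj)
    \<comment> \<open>As \<omega> is proper, some index satisfies both conditions; there the
      normalized rank is at least \<open>\<delta> g\<close> by the approximation and smaller by the
      limit.\<close>
    then obtain k where k: "g \<in> F k" "rho (n k) (a g k - 1\<^sub>m (n k)) < \<delta> g"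
      using eventually_happens'[OF nt] by blast
    let ?M = "a g k - 1\<^sub>m (n k)"
    have M: "?M \<in> carrier_mat (n k) (n k)" by auto
    have "rank_ge {..<n k} {..<n k} (\<lambda>x y. \<phi> k g x y - id_fun_mat x y) (nat \<lceil>\<delta> g * card {..<n k}\<rceil>)"
      using \<phi> k(1) g unfolding approx_rep_def by blast
    moreover have "rank_le {..<n k} {..<n k} (\<lambda>x y. \<phi> k g x y - id_fun_mat x y) (vec_space.rank (n k) ?M)"
      by (rule rank_le_cong[OF rank_le_vec_space_rank[OF M]]) (auto simp: a_def id_fun_mat_def)
    ultimately have "nat \<lceil>\<delta> g * card {..<n k}\<rceil> \<le> vec_space.rank (n k) ?M" by (rule rank_ge_le_rank_le)
    then have "\<delta> g * n k \<le> vec_space.rank (n k) ?M" by (simp add: nat_le_iff ceiling_le_iff)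
    then show False using k(2) npos[of k] unfolding rho_def by (simp add: pos_divide_less_eq)
  qed
  define f where "f g = ?K #>\<^bsub>?P\<^esub> a g" for g
  have f: "f \<in> hom G (GL_ultraproduct \<omega> n)"
  proof (rule homI)
    fix g assume "g \<in> carrier G"
    then show "f g \<in> carrier (GL_ultraproduct \<omega> n)"
      using K.rcosetsI[OF K.subset aP] by (simp add: f_def GL_ultraproduct_def FactGroup_def)
  next
    fix g h assume g: "g \<in> carrier G" and h: "h \<in> carrier G"
    have "f (g \<otimes> h) = ?K #>\<^bsub>?P\<^esub> (a g \<otimes>\<^bsub>?P\<^esub> a h)"
      unfolding f_def rank_null_coset_eq_iff[OF aP[OF m_closed[OF g h]] K.m_closed[OF aP[OF g] aP[OF h]]]
      using mult[OF g h] by simp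
    also have "\<dots> = f g <#>\<^bsub>?P\<^esub> f h"
      unfolding f_def by (rule K.rcos_sum[OF aP[OF g] aP[OF h], symmetric])
    finally show "f (g \<otimes> h) = f g \<otimes>\<^bsub>GL_ultraproduct \<omega> n\<^esub> f h"
      by (simp add: GL_ultraproduct_def FactGroup_def)
  qed
  interpret f: group_hom G "GL_ultraproduct \<omega> n" f
    unfolding group_hom_def group_hom_axioms_def
    using f G K.factorgroup_is_group by (simp add: GL_ultraproduct_def)
  have "kernel G (GL_ultraproduct \<omega> n) f = {\<one>}"
  proof
    show "kernel G (GL_ultraproduct \<omega> n) f \<subseteq> {\<one>}"
    proof
      fix g assume "g \<in> kernel G (GL_ultraproduct \<omega> n) f"
      then have g: "g \<in> carrier G" "f g = f \<one>" by (auto simp: kernel_def)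
      show "g \<in> {\<one>}"
      proof (rule ccontr)
        assume "g \<notin> {\<one>}"
        have "?K #>\<^bsub>?P\<^esub> a g = ?K"
          using g(2) f.hom_one by (simp add: f_def GL_ultraproduct_def FactGroup_def)
        then have "a g \<in> ?K" using K.rcos_self[OF aP[OF g(1)] K.is_subgroup] by simp
        then show False using sep[of g] g(1) \<open>g \<notin> {\<one>}\<close> by (simp add: rank_null_iff)
      qed
    qed
  qed (auto simp: kernel_def)
  then have "inj_on f (carrier G)" using f.inj_iff_trivial_ker by blast
  moreover have "filterlim n at_top sequentially"
    by (rule filterlim_at_top_mono[OF filterlim_ident]) (use n in \<open>auto simp: Suc_le_eq less_imp_le\<close>)
  ultimately show ?thesis using \<omega> f unfolding linear_sofic_def by blast
qed

theorem mainTheorem16: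
  fixes G :: "('a, 'b) monoid_scheme" and H :: "'a set"
  assumes "group G"
    and "countable (carrier G)"
    and "H \<lhd> G"
    and "linear_sofic (G\<lparr>carrier := H\<rparr>)"
    and "amenable (G Mod H)"
  shows "linear_sofic G"
proof -
  interpret normal H G by (rule assms(3))
  have "group (G\<lparr>carrier := H\<rparr>)" using subgroup_is_group[OF is_group] .
  \<comment> \<open>The ultrafilter coming with \<open>H\<close> serves for \<open>G\<close>.
    Halving keeps \<delta> positive on nontrivial elements of \<open>H\<close>, and elsewhere the
    bound is 1/6.\<close>
  from rank_approximable_if_linear_sofic[OF this assms(4)] obtain \<omega> \<delta> where
    \<omega>: "nonprincipal_ultrafilter \<omega>" and \<delta>: "\<And>h. h \<in> H - {\<one>\<^bsub>G\<^esub>} \<Longrightarrow> \<delta> h > 0"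
    and "rank_approximable (G\<lparr>carrier := H\<rparr>) \<delta>" by auto
  then have "rank_approximable G (\<lambda>g. if g \<in> H then \<delta> g / 2 else 1 / 6)"
    using rank_approximable_extension[OF assms(3) _ assms(5)] by blast
  then show ?thesis
    by (rule linear_sofic_if_rank_approximable[OF assms(1,2) \<omega>, rotated]) (use \<delta> in auto)
qed

end
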